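(* Let $H$ be a separable complex Hilbert space, let $\mathcal{I} \subset B(H)$ be an ideal, and let $\phi : \mathcal{I} \to \mathcal{I}$ be a multiplicative map, i.e. $\phi(AB)=\phi(A)\phi(B)$ for all $A,B\in\mathcal{I}$ (neither linearity nor continuity of $\phi$ is assumed). Suppose that for every $A\in \mathcal{I}$ there exists a sequence $(\phi_n)$ of automorphisms of $\mathcal{I}$ (which may depend on $A$) such that $\phi(A)=\lim_n \phi_n(A)$ in the operator norm. (1) If $\mathcal{I}=B(H)$, then $\phi$ is an automorphism of $\mathcal{I}$. (2) If $\mathcal{I} \subsetneq B(H)$, then there is a linear isometry $U: H\to H$ such that $\phi(A)=UAU^*$ for all $A\in \mathcal{I}$. In particular, $\phi$ is a linear *-endomorphism of $\mathcal{I}$.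
   Context: $B(H)$ denotes the $C^*$-algebra of all bounded linear operators on $H$. $H$ may be finite or infinite dimensional. "Ideal" means a two-sided (algebraic) ideal of $B(H)$, not necessarily norm closed; every such ideal is a *-subalgebra of $B(H)$. An automorphism of a *-algebra $\mathcal{A}$ is a linear and multiplicative bijection of $\mathcal{A}$ onto itself which preserves the *-operation. A *-endomorphism is a linear, multiplicative, *-preserving map of the algebra into itself. *)

theory Defs
  imports "HOL-Analysis.Analysis"
begin

text \<open>
  Complex Hilbert spaces. The inner product is linear in the first argument. Nonnegativity and
  definiteness of the inner product follow from \<open>norm_eq_sqrt_cinner\<close>, since \<^term>\<open>sqrt\<close> is odd
  and the norm is nonnegative and definite. Completeness comes from \<^class>\<open>banach\<close>.
  The zero space is included.
\<close>

class complex_hilbert_space = banach +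
  fixes scaleC :: "complex \<Rightarrow> 'a \<Rightarrow> 'a"  (infixr \<open>*\<^sub>C\<close> 75)
    and cinner :: "'a \<Rightarrow> 'a \<Rightarrow> complex"
  assumes scaleC_add_right: "c *\<^sub>C (x + y) = c *\<^sub>C x + c *\<^sub>C y"
    and scaleC_add_left: "(c + d) *\<^sub>C x = c *\<^sub>C x + d *\<^sub>C x"
    and scaleC_scaleC: "c *\<^sub>C d *\<^sub>C x = (c * d) *\<^sub>C x"
    and scaleC_one: "1 *\<^sub>C x = x"
    and scaleR_scaleC: "r *\<^sub>R x = complex_of_real r *\<^sub>C x"
    and cinner_commute: "cinner x y = cnj (cinner y x)"
    and cinner_add_left: "cinner (x + y) z = cinner x z + cinner y z"
    and cinner_scaleC_left: "cinner (c *\<^sub>C x) y = c * cinner x y"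
    and norm_eq_sqrt_cinner: "norm x = sqrt (Re (cinner x x))"

instantiation complex :: complex_hilbert_space
begin

definition scaleC_complex :: "complex \<Rightarrow> complex \<Rightarrow> complex"
  where "scaleC_complex c x = c * x"

definition cinner_complex :: "complex \<Rightarrow> complex \<Rightarrow> complex"
  where "cinner_complex x y = x * cnj y"

instance
  by standard (auto simp: scaleC_complex_def cinner_complex_def algebra_simps
      scaleR_conv_of_real cmod_def power2_eq_square)

end

lemma norm_scaleC: "norm (c *\<^sub>C x) = cmod c * norm (x :: 'h::complex_hilbert_space)"
proof -
  have "cinner (c *\<^sub>C x) (c *\<^sub>C x) = c * cnj c * cinner x x"
    by (metis cinner_commute cinner_scaleC_left complex_cnj_mult mult.assoc mult.commute)
  also have "c * cnj c = complex_of_real ((cmod c)\<^sup>2)"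
    by (metis complex_norm_square of_real_power)
  finally have "Re (cinner (c *\<^sub>C x) (c *\<^sub>C x)) = (cmod c)\<^sup>2 * Re (cinner x x)"
    by simp
  then show ?thesis
    by (simp add: norm_eq_sqrt_cinner[of x] norm_eq_sqrt_cinner[of "c *\<^sub>C x"] real_sqrt_mult)
qed

text \<open>
  Elements of the type \<open>'h \<Rightarrow>\<^sub>L 'h\<close> are the bounded real-linear operators, with the operator norm;
  \<open>B(H)\<close> consists of the complex-linear ones.
\<close>

definition bounded_ops :: "('h::complex_hilbert_space \<Rightarrow>\<^sub>L 'h) set"
  where "bounded_ops = {A. \<forall>c x. blinfun_apply A (c *\<^sub>C x) = c *\<^sub>C blinfun_apply A x}"

definition scale_op ::
    "complex \<Rightarrow> ('h::complex_hilbert_space \<Rightarrow>\<^sub>L 'h) \<Rightarrow> ('h \<Rightarrow>\<^sub>L 'h)"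
  where "scale_op c A = Blinfun (\<lambda>x. c *\<^sub>C blinfun_apply A x)"

lemma bounded_linear_scaleC:
  "bounded_linear (\<lambda>x :: 'h::complex_hilbert_space. c *\<^sub>C x)"
proof (rule bounded_linear_intro)
  fix x y :: 'h and r :: real
  show "c *\<^sub>C (x + y) = c *\<^sub>C x + c *\<^sub>C y"
    by (rule scaleC_add_right)
  show "c *\<^sub>C (r *\<^sub>R x) = r *\<^sub>R (c *\<^sub>C x)"
    by (simp add: scaleR_scaleC scaleC_scaleC mult.commute)
  show "norm (c *\<^sub>C x) \<le> norm x * cmod c"
    by (simp add: norm_scaleC)
qed

lemma scale_op_apply: "blinfun_apply (scale_op c A) x = c *\<^sub>C blinfun_apply A x"
  unfolding scale_op_def
  by (subst bounded_linear_Blinfun_apply)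
     (auto intro: bounded_linear_compose[OF bounded_linear_scaleC] blinfun.bounded_linear_right)

text \<open>Meaningful for \<open>A \<in> bounded_ops\<close>, where existence is the Riesz representation theorem.\<close>

definition adj :: "('h::complex_hilbert_space \<Rightarrow>\<^sub>L 'h) \<Rightarrow> ('h \<Rightarrow>\<^sub>L 'h)"
  where "adj A = (THE B. B \<in> bounded_ops \<and>
    (\<forall>x y. cinner (blinfun_apply A x) y = cinner x (blinfun_apply B y)))"

definition operator_ideal :: "('h::complex_hilbert_space \<Rightarrow>\<^sub>L 'h) set \<Rightarrow> bool"
  where "operator_ideal I \<longleftrightarrow>
    I \<subseteq> bounded_ops \<and>
    0 \<in> I \<and>
    (\<forall>A\<in>I. \<forall>B\<in>I. A + B \<in> I) \<and>
    (\<forall>c. \<forall>A\<in>I. scale_op c A \<in> I) \<and>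
    (\<forall>A\<in>I. \<forall>B\<in>bounded_ops. A o\<^sub>L B \<in> I \<and> B o\<^sub>L A \<in> I)"

definition multiplicative_on ::
    "('h::complex_hilbert_space \<Rightarrow>\<^sub>L 'h) set \<Rightarrow> (('h \<Rightarrow>\<^sub>L 'h) \<Rightarrow> ('h \<Rightarrow>\<^sub>L 'h)) \<Rightarrow> bool"
  where "multiplicative_on I \<phi> \<longleftrightarrow> (\<forall>A\<in>I. \<forall>B\<in>I. \<phi> (A o\<^sub>L B) = \<phi> A o\<^sub>L \<phi> B)"

text \<open>
  Maps on \<open>I\<close> are represented by functions on the whole operator type; only their values on \<open>I\<close>
  are constrained.
\<close>

definition star_endomorphism ::
    "('h::complex_hilbert_space \<Rightarrow>\<^sub>L 'h) set \<Rightarrow> (('h \<Rightarrow>\<^sub>L 'h) \<Rightarrow> ('h \<Rightarrow>\<^sub>L 'h)) \<Rightarrow> bool"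
  where "star_endomorphism I \<phi> \<longleftrightarrow>
    \<phi> \<in> I \<rightarrow> I \<and>
    (\<forall>A\<in>I. \<forall>B\<in>I. \<phi> (A + B) = \<phi> A + \<phi> B) \<and>
    (\<forall>c. \<forall>A\<in>I. \<phi> (scale_op c A) = scale_op c (\<phi> A)) \<and>
    multiplicative_on I \<phi> \<and>
    (\<forall>A\<in>I. \<phi> (adj A) = adj (\<phi> A))"

definition star_automorphism ::
    "('h::complex_hilbert_space \<Rightarrow>\<^sub>L 'h) set \<Rightarrow> (('h \<Rightarrow>\<^sub>L 'h) \<Rightarrow> ('h \<Rightarrow>\<^sub>L 'h)) \<Rightarrow> bool"
  where "star_automorphism I \<phi> \<longleftrightarrow> star_endomorphism I \<phi> \<and> bij_betw \<phi> I I"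

definition linear_isometry :: "('h::complex_hilbert_space \<Rightarrow>\<^sub>L 'h) \<Rightarrow> bool"
  where "linear_isometry U \<longleftrightarrow> U \<in> bounded_ops \<and> (\<forall>x. norm (blinfun_apply U x) = norm x)"

end

theory Submission
  imports Defs
begin

text \<open>
  Automorphisms of \<open>I\<close> are implemented by unitaries, so \<open>\<phi>\<close> preserves norms and maps rank one
  projections to rank one projections; multiplicativity on rank one operators then yields a linear
  isometry \<open>U\<close> whose range reduces every \<open>\<phi>(A)\<close>, with \<open>\<phi>(A) U = U A\<close>. If \<open>A\<close> is compact, \<open>\<phi>(A)\<close>
  vanishes on the orthogonal complement \<open>N\<close> of the range of \<open>U\<close>, since otherwise \<open>\<phi>(A)\<close> would have
  one singular value more than the operators unitarily equivalent to \<open>A\<close> that approximate it. An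
  ideal with a noncompact element is all of \<open>B(H)\<close>. In that case \<open>\<phi>(1) = 1\<close>, and a nonzero vector
  of \<open>N\<close> would be moved to uncountably many uniformly separated ones, so \<open>N = 0\<close>.
\<close>

subsection \<open>Hilbert space operators\<close>

text \<open>The automorphisms approximating \<open>\<phi> A\<close> depend on \<open>A\<close>, so
  only properties of a single operator that survive unitary equivalence and norm limits can be
  transferred: the norm, algebraic identities of rank one operators, counts of singular values. None
  of these links \<open>\<phi>\<close> of a sum or of an adjoint to other values of
  \<open>\<phi>\<close>; multiplicativity is the only link. Additivity and compatibility with
  adjoints are therefore read off at the end, from the formula for \<open>\<phi>\<close>. The
  obstacle is the action of \<open>\<phi> A\<close> on \<open>N\<close>: once it vanishes for
  compact \<open>A\<close>, it looks like a representation of the Calkin algebra. The uncountable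
  family is the classical argument that this algebra has no nonzero representation on a separable
  space, carried out with products and norms alone. Separability enters a second time when a
  noncompact element is shown to generate \<open>B(H)\<close>. Closure under adjoints is not part of
  \<open>operator_ideal\<close>; deriving it is what calls for absolute values.\<close>

lemma cinner_add_right:
  "cinner x (y + z) = cinner x y + cinner (x :: 'h::complex_hilbert_space) z"
  by (metis cinner_add_left cinner_commute complex_cnj_add)

lemma cinner_scaleC_right:
  "cinner x (c *\<^sub>C y) = cnj c * cinner (x :: 'h::complex_hilbert_space) y"
  by (metis cinner_commute cinner_scaleC_left complex_cnj_mult)

lemma cinner_self: "cinner x x = complex_of_real ((norm (x :: 'h::complex_hilbert_space))\<^sup>2)"
proof -
  have "Im (cinner x x) = 0"
    using cinner_commute[of x x] by (metis complex_cnj_cancel_iff Reals_cnj_iff complex_is_Real_iff)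
  moreover have "0 \<le> Re (cinner x x)"
    using norm_eq_sqrt_cinner[of x] by (metis norm_ge_zero real_sqrt_ge_0_iff)
  ultimately show ?thesis
    by (simp add: complex_eq_iff norm_eq_sqrt_cinner[of x])
qed

lemma cinner_scaleR_left: "cinner (r *\<^sub>R x) y = r *\<^sub>R cinner (x :: 'h::complex_hilbert_space) y"
  by (simp add: scaleR_scaleC[where 'a = 'h] cinner_scaleC_left scaleR_conv_of_real)

lemma cinner_scaleR_right: "cinner x (r *\<^sub>R y) = r *\<^sub>R cinner (x :: 'h::complex_hilbert_space) y"
  by (simp add: scaleR_scaleC[where 'a = 'h] cinner_scaleC_right scaleR_conv_of_real)

lemma norm_add_square:
  "(norm (x + y :: 'h::complex_hilbert_space))\<^sup>2 = (norm x)\<^sup>2 + 2 * Re (cinner x y) + (norm y)\<^sup>2"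
proof -
  have "cinner (x + y) (x + y) = cinner x x + cinner x y + (cinner y x + cinner y y)"
    by (simp add: cinner_add_left cinner_add_right)
  then have "Re (cinner (x + y) (x + y)) = Re \<dots>" by simp
  then have "(norm (x + y))\<^sup>2 = (norm x)\<^sup>2 + Re (cinner x y) + Re (cinner y x) + (norm y)\<^sup>2"
    by (simp add: cinner_self)
  moreover have "Re (cinner y x) = Re (cinner x y)" by (subst cinner_commute) simp
  ultimately show ?thesis by simp
qed

lemma Cauchy_Schwarz_cinner:
  "cmod (cinner x y) \<le> norm x * norm (y :: 'h::complex_hilbert_space)"
proof (cases "y = 0")
  case True
  have "cinner x (0 *\<^sub>R y) = 0" by (subst cinner_scaleR_right) simp
  then show ?thesis using True by simp
next
  case False
  \<comment> \<open>This \<open>c\<close> minimises \<open>norm (x + c *\<^sub>C y)\<close>: it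
    removes from \<open>x\<close> the component along \<open>y\<close>.\<close>
  define c where "c = - cinner x y / complex_of_real ((norm y)\<^sup>2)"
  have ny: "(norm y)\<^sup>2 > 0" using False by simp
  have "0 \<le> (norm (x + c *\<^sub>C y))\<^sup>2" by simp
  also have "\<dots> = (norm x)\<^sup>2 + 2 * Re (cnj c * cinner x y) + (cmod c)\<^sup>2 * (norm y)\<^sup>2"
    by (simp add: norm_add_square cinner_scaleC_right norm_scaleC power_mult_distrib)
  also have "cnj c * cinner x y = complex_of_real (- (cmod (cinner x y))\<^sup>2 / (norm y)\<^sup>2)"
    unfolding c_def by (simp add: mult.commute complex_norm_square[symmetric] flip: of_real_power)
  also have "(cmod c)\<^sup>2 * (norm y)\<^sup>2 = (cmod (cinner x y))\<^sup>2 / (norm y)\<^sup>2"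
    unfolding c_def using ny
    by (simp add: norm_divide norm_power power_divide) (simp add: power2_eq_square power4_eq_xxxx)
  finally have "(cmod (cinner x y))\<^sup>2 / (norm y)\<^sup>2 \<le> (norm x)\<^sup>2" by simp
  then have "(cmod (cinner x y))\<^sup>2 \<le> (norm x * norm y)\<^sup>2"
    using ny by (simp add: divide_le_eq power_mult_distrib)
  then show ?thesis by (rule power2_le_imp_le) simp
qed

interpretation cinner: bounded_bilinear
  "cinner :: 'h::complex_hilbert_space \<Rightarrow> 'h \<Rightarrow> complex"
  by unfold_locales
    (auto simp: cinner_add_left cinner_add_right cinner_scaleR_left cinner_scaleR_right
      intro!: exI[of _ 1] Cauchy_Schwarz_cinner)

interpretation scaleC: bounded_bilinear
  "scaleC :: complex \<Rightarrow> 'h::complex_hilbert_space \<Rightarrow> 'h"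
  by unfold_locales
    (auto simp: scaleC_add_left scaleC_add_right scaleR_scaleC[where 'a = 'h] scaleC_scaleC
      scaleR_conv_of_real mult.commute norm_scaleC intro!: exI[of _ 1])

declare scaleC_one [simp] cinner.zero_left [simp] cinner.zero_right [simp]
  scaleC.zero_left [simp] scaleC.zero_right [simp] scaleC_scaleC [simp]

lemma norm_diff_square:
  "(norm (x - y :: 'h::complex_hilbert_space))\<^sup>2 = (norm x)\<^sup>2 - 2 * Re (cinner x y) + (norm y)\<^sup>2"
  using norm_add_square[of x "- y"] by (simp add: cinner.minus_right)

lemma cinner_eq_0_commute:
  "cinner x y = 0 \<longleftrightarrow> cinner y (x :: 'h::complex_hilbert_space) = 0"
  by (metis cinner_commute complex_cnj_zero)

lemma norm_add_square_orthogonal: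
  "cinner x y = 0 \<Longrightarrow> (norm (x + y :: 'h::complex_hilbert_space))\<^sup>2 = (norm x)\<^sup>2 + (norm y)\<^sup>2"
  by (simp add: norm_add_square)

lemma cinner_eq_right:
  assumes "\<And>x. cinner x y = cinner x (z :: 'h::complex_hilbert_space)"
  shows "y = z"
proof -
  have "cinner (y - z) (y - z) = 0"
    using assms[of "y - z"] by (simp add: cinner.diff_right)
  then show ?thesis by (simp add: cinner_self)
qed

lemma cinner_eq_left:
  assumes "\<And>x. cinner y x = cinner (z :: 'h::complex_hilbert_space) x"
  shows "y = z"
  by (rule cinner_eq_right) (metis assms cinner_commute)

lemma bounded_opsI:
  assumes add: "\<And>x y. f (x + y) = f x + f y"
    and scale: "\<And>c x. f (c *\<^sub>C x) = c *\<^sub>C f x"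
    and bound: "\<And>x. norm (f x) \<le> K * norm x"
  obtains T :: "'h::complex_hilbert_space \<Rightarrow>\<^sub>L 'h" where
    "T \<in> bounded_ops" "\<And>x. T x = f x"
proof -
  have "bounded_linear f"
    by (rule bounded_linear_intro[where K = K])
      (use assms in \<open>auto simp: scaleR_scaleC mult.commute\<close>)
  then have "blinfun_apply (Blinfun f) = f" by (rule bounded_linear_Blinfun_apply)
  then show ?thesis using scale by (intro that[of "Blinfun f"]) (auto simp: bounded_ops_def)
qed

lemma bounded_ops_scaleC:
  "A \<in> bounded_ops \<Longrightarrow> blinfun_apply A (c *\<^sub>C x) = c *\<^sub>C blinfun_apply A x"
  by (simp add: bounded_ops_def)

lemma bounded_ops_compose: "A \<in> bounded_ops \<Longrightarrow> B \<in> bounded_ops \<Longrightarrow> A o\<^sub>L B \<in> bounded_ops"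
  by (simp add: bounded_ops_def)

lemma bounded_ops_diff: "A \<in> bounded_ops \<Longrightarrow> B \<in> bounded_ops \<Longrightarrow> A - B \<in> bounded_ops"
  by (simp add: bounded_ops_def blinfun.diff_left scaleC.diff_right)

lemma bounded_ops_id: "id_blinfun \<in> bounded_ops"
  by (simp add: bounded_ops_def)

lemma bounded_ops_scaleR: "A \<in> bounded_ops \<Longrightarrow> r *\<^sub>R A \<in> bounded_ops"
  by (simp add: bounded_ops_def blinfun.scaleR_left scaleR_scaleC mult.commute)

lemma bounded_ops_lim:
  assumes "\<And>n. X n \<in> bounded_ops" "X \<longlonglongrightarrow> A"
  shows "A \<in> bounded_ops"
proof -
  have "A (c *\<^sub>C x) = c *\<^sub>C A x" for c x
  proof (rule LIMSEQ_unique)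
    show "(\<lambda>n. X n (c *\<^sub>C x)) \<longlonglongrightarrow> A (c *\<^sub>C x)"
      by (intro tendsto_intros assms)
    have "(\<lambda>n. c *\<^sub>C X n x) \<longlonglongrightarrow> c *\<^sub>C A x"
      by (intro scaleC.tendsto tendsto_intros assms)
    then show "(\<lambda>n. X n (c *\<^sub>C x)) \<longlonglongrightarrow> c *\<^sub>C A x"
      using assms(1) by (simp add: bounded_ops_scaleC)
  qed
  then show ?thesis by (simp add: bounded_ops_def)
qed

section \<open>Riesz representation, Douglas factorization and adjoints\<close>

text \<open>Minimising \<open>\<parallel>S x\<parallel>\<^sup>2 - 2 Re (g x)\<close>: the images under \<open>S\<close> of a minimising sequence converge.\<close>

lemma Riesz_on_range:
  fixes S :: "'h::complex_hilbert_space \<Rightarrow>\<^sub>L 'h" and g :: "'h \<Rightarrow> complex"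
  assumes S: "S \<in> bounded_ops"
    and add: "\<And>x y. g (x + y) = g x + g y"
    and scale: "\<And>c x. g (c *\<^sub>C x) = c * g x"
    and bound: "\<And>x. cmod (g x) \<le> M * norm (S x)"
  shows "\<exists>z\<in>closure (range S). \<forall>x. g x = cinner (S x) z"
proof -
  define q where "q x = (norm (S x))\<^sup>2 - 2 * Re (g x)" for x
  have q_bound: "- M\<^sup>2 \<le> q x" for x
  proof -
    have "Re (g x) \<le> M * norm (S x)" using bound[of x] complex_Re_le_cmod[of "g x"] by linarith
    moreover have "0 \<le> (norm (S x) - M)\<^sup>2" by simp
    ultimately show ?thesis unfolding q_def by (simp add: power2_diff mult.commute)
  qed
  define m where "m = Inf (range q)"
  have bdd: "bdd_below (range q)" using q_bound by (auto intro!: bdd_belowI)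
  have m_le: "m \<le> q x" for x unfolding m_def by (intro cInf_lower bdd) auto
  have "\<exists>x. q x < m + 1 / real (Suc n)" for n
  proof -
    have "Inf (range q) < m + 1 / real (Suc n)" by (simp add: m_def)
    then show ?thesis by (subst (asm) cInf_less_iff) (use bdd in auto)
  qed
  then obtain X where X: "\<And>n. q (X n) < m + 1 / real (Suc n)" by metis
  \<comment> \<open>Parallelogram law, with \<open>m \<le> q\<close> applied at the midpoint of
    \<open>x\<close> and \<open>y\<close>.\<close>
  have par: "(norm (S x - S y))\<^sup>2 \<le> 2 * q x + 2 * q y - 4 * m" for x y
  proof -
    have g2: "g ((1/2) *\<^sub>R (x + y)) = (g x + g y) / 2"
      by (simp add: scaleR_scaleC scale add)
    have "(norm (S ((1/2) *\<^sub>R (x + y))))\<^sup>2 = (norm (S x + S y))\<^sup>2 / 4"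
      by (simp only: blinfun.scaleR_right blinfun.add_right norm_scaleR power_mult_distrib)
        (simp add: power_divide)
    then have "4 * q ((1/2) *\<^sub>R (x + y)) = (norm (S x + S y))\<^sup>2 - 4 * Re (g x) - 4 * Re (g y)"
      unfolding q_def g2 by (simp add: field_simps)
    then show ?thesis
      using m_le[of "(1/2) *\<^sub>R (x + y)"]
      unfolding q_def by (simp add: norm_add_square norm_diff_square)
  qed
  have "Cauchy (\<lambda>n. S (X n))"
  proof (rule metric_CauchyI)
    fix \<epsilon> :: real assume e: "\<epsilon> > 0"
    obtain N where N: "1 / real (Suc N) < \<epsilon>\<^sup>2 / 4"
      using nat_approx_posE[of "\<epsilon>\<^sup>2 / 4"] e by auto
    have small: "q (X n) < m + \<epsilon>\<^sup>2 / 4" if "n \<ge> N" for n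
    proof -
      have "1 / real (Suc n) \<le> 1 / real (Suc N)" using that by (simp add: frac_le)
      then show ?thesis using X[of n] N by linarith
    qed
    have "dist (S (X i)) (S (X j)) < \<epsilon>" if "i \<ge> N" "j \<ge> N" for i j
    proof -
      have "(norm (S (X i) - S (X j)))\<^sup>2 < \<epsilon>\<^sup>2"
        using par[of "X i" "X j"] small[OF that(1)] small[OF that(2)] by linarith
      then show ?thesis using e by (metis dist_norm less_le power2_less_imp_less)
    qed
    then show "\<exists>N. \<forall>i\<ge>N. \<forall>j\<ge>N. dist (S (X i)) (S (X j)) < \<epsilon>" by blast
  qed
  then obtain z where z: "(\<lambda>n. S (X n)) \<longlonglongrightarrow> z"
    using Cauchy_convergent convergent_def by blast
  have q_lim: "(\<lambda>n. q (X n)) \<longlonglongrightarrow> m"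
  proof (rule real_tendsto_sandwich)
    show "(\<lambda>n. m) \<longlonglongrightarrow> m" by simp
    show "(\<lambda>n. m + 1 / real (Suc n)) \<longlonglongrightarrow> m"
      using tendsto_add[OF tendsto_const LIMSEQ_inverse_real_of_nat, of m]
      by (simp add: inverse_eq_divide)
  qed (use m_le X less_imp_le in \<open>auto intro!: always_eventually\<close>)
  \<comment> \<open>First variation at the infimum: moving \<open>X n\<close> by
    \<open>t *\<^sub>R x\<close> cannot push \<open>q\<close> below \<open>m\<close>. In the limit a
    quadratic in \<open>t\<close> without constant term is nonnegative, so its linear coefficient
    \<open>r\<close> vanishes.\<close>
  have Re_eq: "Re (g x) = Re (cinner (S x) z)" for x
  proof -
    define r where "r = Re (cinner (S x) z) - Re (g x)"
    define b where "b = (norm (S x))\<^sup>2"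
    have pos: "0 \<le> 2 * t * r + t\<^sup>2 * b" for t
    proof (rule LIMSEQ_le_const)
      show "\<exists>N. \<forall>n\<ge>N. 0 \<le>
        q (X n) - m + 2 * t * (Re (cinner (S x) (S (X n))) - Re (g x)) + t\<^sup>2 * b"
      proof (intro exI allI impI)
        fix n
        have "q (X n + t *\<^sub>R x) =
            q (X n) + 2 * t * (Re (cinner (S (X n)) (S x)) - Re (g x)) + t\<^sup>2 * b"
          unfolding q_def b_def
          by (simp add: blinfun.add_right norm_add_square add scaleR_scaleC bounded_ops_scaleC[OF S]
            scale norm_scaleC power_mult_distrib cinner_scaleC_right algebra_simps)
        moreover have "Re (cinner (S (X n)) (S x)) = Re (cinner (S x) (S (X n)))"
          by (subst cinner_commute) simp
        ultimately show "0 \<le> q (X n) - m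
            + 2 * t * (Re (cinner (S x) (S (X n))) - Re (g x)) + t\<^sup>2 * b"
          using m_le[of "X n + t *\<^sub>R x"] by simp
      qed
      have "(\<lambda>n. q (X n) - m + 2 * t * (Re (cinner (S x) (S (X n))) - Re (g x)) + t\<^sup>2 * b)
          \<longlonglongrightarrow> m - m + 2 * t * (Re (cinner (S x) z) - Re (g x)) + t\<^sup>2 * b"
        by (intro tendsto_intros q_lim cinner.tendsto z)
      then show "(\<lambda>n. q (X n) - m + 2 * t * (Re (cinner (S x) (S (X n))) - Re (g x)) + t\<^sup>2 * b)
          \<longlonglongrightarrow> 2 * t * r + t\<^sup>2 * b" by (simp add: r_def)
    qed
    have b0: "b \<ge> 0" by (simp add: b_def)
    have "r = 0"
    proof (rule ccontr)
      assume "r \<noteq> 0"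
      \<comment> \<open>The minimiser of the quadratic would be \<open>- r / b\<close>; adding 1 to
        the denominator covers \<open>b = 0\<close>.\<close>
      define t where "t = - r / (b + 1)"
      have tb: "t * (b + 1) = - r" using b0 by (simp add: t_def)
      have "0 \<le> (2 * t * r + t\<^sup>2 * b) * (b + 1)\<^sup>2" by (intro mult_nonneg_nonneg pos) simp
      also have "\<dots> = 2 * (t * (b + 1)) * (b + 1) * r + (t * (b + 1))\<^sup>2 * b"
        by (simp add: power2_eq_square algebra_simps)
      also have "\<dots> = r\<^sup>2 * (- b - 2)"
        unfolding tb by (simp add: power2_eq_square algebra_simps)
      also have "\<dots> < 0" using \<open>r \<noteq> 0\<close> b0 by (intro mult_pos_neg) auto
      finally show False by simp
    qed
    then show ?thesis by (simp add: r_def)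
  qed
  have "g x = cinner (S x) z" for x
  proof (rule complex_eqI)
    show "Re (g x) = Re (cinner (S x) z)" by (rule Re_eq)
    show "Im (g x) = Im (cinner (S x) z)"
      using Re_eq[of "\<i> *\<^sub>C x"] by (simp add: scale bounded_ops_scaleC[OF S] cinner_scaleC_left)
  qed
  moreover have "z \<in> closure (range S)"
    unfolding closure_sequential using z by (intro exI[of _ "\<lambda>n. S (X n)"]) auto
  ultimately show ?thesis by blast
qed

lemma orthogonal_closure:
  assumes "z \<in> closure R" "\<And>x. x \<in> R \<Longrightarrow> cinner x w = (0::complex)"
  shows "cinner z (w :: 'h::complex_hilbert_space) = 0"
proof -
  obtain X where X: "\<And>n. X n \<in> R" "X \<longlonglongrightarrow> z" using assms(1) by (auto simp: closure_sequential)
  then have "(\<lambda>n. cinner (X n) w) \<longlonglongrightarrow> cinner z w" by (intro cinner.tendsto tendsto_const)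
  moreover have "(\<lambda>n. cinner (X n) w) = (\<lambda>n. 0)" using X assms(2) by auto
  ultimately show ?thesis by (metis LIMSEQ_unique tendsto_const)
qed

text \<open>For fixed \<open>y\<close> the functional sending \<open>x\<close> to
  \<open>cinner (A x) y\<close> is bounded in terms of \<open>S x\<close>, so a vector in the
  closure of the range of \<open>S\<close> represents it, and uniqueness there makes the choice
  linear in \<open>y\<close>. The conclusion expresses that \<open>A\<close> is \<open>adj T\<close>
  after \<open>S\<close>, but without \<open>adj\<close>, because the existence of adjoints is
  itself obtained from the case \<open>S = id_blinfun\<close>.\<close>

lemma Douglas_factorization:
  fixes A S :: "'h::complex_hilbert_space \<Rightarrow>\<^sub>L 'h"
  assumes A: "A \<in> bounded_ops" and S: "S \<in> bounded_ops"
    and bound: "\<And>x. norm (A x) \<le> M * norm (S x)" and M: "0 \<le> M"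
  obtains T where "T \<in> bounded_ops" "\<And>x y. cinner (A x) y = cinner (S x) (blinfun_apply T y)"
proof -
  define R where "R = closure (range S)"
  have "\<exists>z\<in>R. \<forall>x. cinner (A x) y = cinner (S x) z" for y
    unfolding R_def
  proof (rule Riesz_on_range[OF S, where M = "M * norm y"])
    show "cmod (cinner (A x) y) \<le> M * norm y * norm (S x)" for x
      using Cauchy_Schwarz_cinner[of "A x" y] mult_right_mono[OF bound[of x] norm_ge_zero[of y]]
      by (simp add: mult_ac)
  qed (simp_all add: blinfun.add_right cinner_add_left bounded_ops_scaleC[OF A] cinner_scaleC_left)
  then obtain f where f: "\<And>y. f y \<in> R" "\<And>x y. cinner (A x) y = cinner (S x) (f y)" by metis
  have sub_add: "v + w \<in> R" if vw: "v \<in> R" "w \<in> R" for v w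
  proof -
    obtain X Y where X: "X \<longlonglongrightarrow> v" "\<And>n. X n \<in> range S" and Y: "Y \<longlonglongrightarrow> w" "\<And>n. Y n \<in> range S"
      using vw unfolding R_def closure_sequential by metis
    have "X n + Y n \<in> range S" for n
      using X(2)[of n] Y(2)[of n] by (auto simp flip: blinfun.add_right)
    then show ?thesis
      unfolding R_def closure_sequential
      by (intro exI[of _ "\<lambda>n. X n + Y n"]) (auto intro!: tendsto_add X Y)
  qed
  have sub_scale: "c *\<^sub>C v \<in> R" if v: "v \<in> R" for c v
  proof -
    obtain X where X: "X \<longlonglongrightarrow> v" "\<And>n. X n \<in> range S"
      using v unfolding R_def closure_sequential by blast
    have "c *\<^sub>C X n \<in> range S" for n
      using X(2)[of n] by (auto simp flip: bounded_ops_scaleC[OF S])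
    then show ?thesis
      unfolding R_def closure_sequential
      by (intro exI[of _ "\<lambda>n. c *\<^sub>C X n"]) (auto intro!: scaleC.tendsto X)
  qed
  \<comment> \<open>The difference lies in the closure of the range of \<open>S\<close> and is
    orthogonal to that range, hence to itself.\<close>
  have unique: "v = w" if "v \<in> R" "w \<in> R" "\<And>x. cinner (S x) v = cinner (S x) w" for v w
  proof -
    have "v + (-1) *\<^sub>C w \<in> R" by (intro sub_add sub_scale that)
    also have "v + (-1) *\<^sub>C w = v - w" by (simp add: scaleC.minus_left)
    finally have "cinner (v - w) (v - w) = 0"
      unfolding R_def by (rule orthogonal_closure) (auto simp: cinner.diff_right that(3))
    then show ?thesis by (simp add: cinner_self)
  qed
  obtain T :: "'h \<Rightarrow>\<^sub>L 'h" where "T \<in> bounded_ops" "\<And>y. T y = f y"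
  proof (rule bounded_opsI[of f M])
    show "f (x + y) = f x + f y" for x y
      by (rule unique) (auto simp: f(1) sub_add f(2)[symmetric] cinner_add_right)
    show "f (c *\<^sub>C y) = c *\<^sub>C f y" for c y
      by (rule unique) (auto simp: f(1) sub_scale f(2)[symmetric] cinner_scaleC_right)
    show "norm (f y) \<le> M * norm y" for y
    proof -
      \<comment> \<open>Since \<open>f y\<close> is a limit of vectors \<open>S x\<close>, the
        estimate for \<open>cinner (S x) (f y)\<close> can be tested at \<open>f y\<close>
        itself.\<close>
      obtain X where X: "\<And>n. X n \<in> range S" "X \<longlonglongrightarrow> f y"
        using f(1)[of y] unfolding R_def closure_sequential by blast
      have "cmod (cinner (X n) (f y)) \<le> M * norm (X n) * norm y" for n
      proof -
        obtain x where x: "X n = S x" using X(1)[of n] by blast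
        have "cmod (cinner (S x) (f y)) \<le> norm (A x) * norm y"
          using Cauchy_Schwarz_cinner[of "A x" y] by (simp add: f(2))
        also have "\<dots> \<le> M * norm (S x) * norm y" by (intro mult_right_mono bound) simp
        finally show ?thesis by (simp add: x)
      qed
      moreover have "(\<lambda>n. cmod (cinner (X n) (f y))) \<longlonglongrightarrow> cmod (cinner (f y) (f y))"
        by (intro tendsto_norm cinner.tendsto X tendsto_const)
      moreover have "(\<lambda>n. M * norm (X n) * norm y) \<longlonglongrightarrow> M * norm (f y) * norm y"
        by (intro tendsto_intros X)
      ultimately have "cmod (cinner (f y) (f y)) \<le> M * norm (f y) * norm y"
        by (intro LIMSEQ_le) auto
      then have "norm (f y) * norm (f y) \<le> norm (f y) * (M * norm y)"
        by (simp add: cinner_self power2_eq_square norm_mult mult_ac)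
      then show ?thesis
        using M by (cases "f y = 0") (auto simp: mult_le_cancel_left)
    qed
  qed auto
  then show ?thesis using that[of T] f(2) by metis
qed

lemma adjoint_unique:
  assumes "\<And>x y. cinner (blinfun_apply A x) y = cinner x (blinfun_apply B y)"
    and "\<And>x y. cinner (blinfun_apply A x) y = cinner x (blinfun_apply C y)"
  shows "B = (C :: 'h::complex_hilbert_space \<Rightarrow>\<^sub>L 'h)"
  by (rule blinfun_eqI, rule cinner_eq_right) (metis assms)

lemma adj_eqI:
  assumes "B \<in> bounded_ops" "\<And>x y. cinner (blinfun_apply A x) y = cinner x (blinfun_apply B y)"
  shows "adj A = (B :: 'h::complex_hilbert_space \<Rightarrow>\<^sub>L 'h)"
  unfolding adj_def
  by (rule the_equality) (use assms adjoint_unique in blast)+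

lemma
  fixes A :: "'h::complex_hilbert_space \<Rightarrow>\<^sub>L 'h"
  assumes A: "A \<in> bounded_ops"
  shows bounded_ops_adj: "adj A \<in> bounded_ops"
    and cinner_adj: "cinner (A x) y = cinner x (adj A y)"
proof -
  obtain B where B: "B \<in> bounded_ops" "\<And>x y. cinner (A x) y = cinner (id_blinfun x) (blinfun_apply B y)"
    using Douglas_factorization[OF A bounded_ops_id, of "norm A"] norm_blinfun by auto
  moreover have "adj A = B" using B by (intro adj_eqI) auto
  ultimately show "adj A \<in> bounded_ops" "cinner (A x) y = cinner x (adj A y)" by auto
qed

lemma cinner_adj_left:
  "A \<in> bounded_ops \<Longrightarrow> cinner (adj A x) y = cinner x (blinfun_apply A (y::'h::complex_hilbert_space))"
  by (metis cinner_adj cinner_commute)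

lemma adj_adj: "A \<in> bounded_ops \<Longrightarrow> adj (adj A) = (A :: 'h::complex_hilbert_space \<Rightarrow>\<^sub>L 'h)"
  by (rule adj_eqI) (auto simp: cinner_adj_left)

lemma adj_compose:
  "A \<in> bounded_ops \<Longrightarrow> B \<in> bounded_ops \<Longrightarrow>
    adj (A o\<^sub>L B) = adj B o\<^sub>L adj (A :: 'h::complex_hilbert_space \<Rightarrow>\<^sub>L 'h)"
  by (rule adj_eqI) (auto simp: cinner_adj bounded_ops_compose bounded_ops_adj)

subsection \<open>Orthogonal sequences\<close>

definition orthogonal_contractions :: "(nat \<Rightarrow> 'h::complex_hilbert_space) \<Rightarrow> bool"
  where "orthogonal_contractions a \<longleftrightarrow>
    (\<forall>m n. m \<noteq> n \<longrightarrow> cinner (a m) (a n) = 0) \<and> (\<forall>n. norm (a n) \<le> 1)"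

lemma orthogonal_contractions_subseq:
  "orthogonal_contractions a \<Longrightarrow> inj k \<Longrightarrow> orthogonal_contractions (\<lambda>n. a (k n))"
  by (simp add: orthogonal_contractions_def inj_eq)

lemma norm_orthogonal_sum_square:
  assumes a: "orthogonal_contractions a" and "finite F"
  shows "(norm (\<Sum>n\<in>F. c n *\<^sub>C a n))\<^sup>2 = (\<Sum>n\<in>F. (cmod (c n))\<^sup>2 * (norm (a n))\<^sup>2)"
  using \<open>finite F\<close>
proof induction
  case (insert m F)
  have "cinner (c m *\<^sub>C a m) (\<Sum>n\<in>F. c n *\<^sub>C a n) = 0"
    unfolding cinner.sum_right
  proof (intro sum.neutral ballI)
    fix x assume "x \<in> F"
    then have "m \<noteq> x" using insert.hyps by blast
    then have "cinner (a m) (a x) = 0" using a by (simp add: orthogonal_contractions_def)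
    then show "cinner (c m *\<^sub>C a m) (c x *\<^sub>C a x) = 0"
      by (simp add: cinner_scaleC_left cinner_scaleC_right)
  qed
  then show ?case
    using insert by (simp add: norm_add_square_orthogonal norm_scaleC power_mult_distrib)
qed simp

lemma norm_orthogonal_sum_square_le:
  assumes "orthogonal_contractions a" and "finite F"
  shows "(norm (\<Sum>n\<in>F. c n *\<^sub>C a n))\<^sup>2 \<le> (\<Sum>n\<in>F. (cmod (c n))\<^sup>2)"
  unfolding norm_orthogonal_sum_square[OF assms]
  using assms(1) by (intro sum_mono mult_right_le_one_le)
    (auto simp: orthogonal_contractions_def intro: power_le_one)

text \<open>The vectors need not have norm 1, so \<open>w\<close> need not be the orthogonal
  projection of \<open>v\<close>; the bound of its squared norm by \<open>s\<close> is still
  enough.\<close>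

lemma Bessel_inequality:
  assumes "orthogonal_contractions a" and "finite F"
  shows "(\<Sum>n\<in>F. (cmod (cinner v (a n)))\<^sup>2) \<le> (norm v)\<^sup>2"
proof -
  define w where "w = (\<Sum>n\<in>F. cinner v (a n) *\<^sub>C a n)"
  define s where "s = (\<Sum>n\<in>F. (cmod (cinner v (a n)))\<^sup>2)"
  have "cinner v w = (\<Sum>n\<in>F. cnj (cinner v (a n)) * cinner v (a n))"
    unfolding w_def cinner.sum_right by (simp add: cinner_scaleC_right)
  also have "\<dots> = complex_of_real s"
    unfolding s_def of_real_sum
    by (intro sum.cong refl) (simp add: mult.commute[of "cnj _"] complex_norm_square del: of_real_power)
  finally have "(norm (v - w))\<^sup>2 = (norm v)\<^sup>2 - 2 * s + (norm w)\<^sup>2"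
    by (simp add: norm_diff_square)
  moreover have "(norm w)\<^sup>2 \<le> s"
    unfolding w_def s_def by (rule norm_orthogonal_sum_square_le[OF assms])
  ultimately show ?thesis
    unfolding s_def[symmetric] using zero_le_power2[of "norm (v - w)"] by linarith
qed

text \<open>For orthonormal \<open>a\<close> and \<open>b\<close> this is the partial isometry
  carrying \<open>a n\<close> to \<open>b n\<close>. Bessel's inequality for \<open>a\<close> and
  Pythagoras for \<open>b\<close> control the tails of the series.\<close>

lemma orthogonal_operator:
  fixes a b :: "nat \<Rightarrow> 'h::complex_hilbert_space"
  assumes a: "orthogonal_contractions a" and b: "orthogonal_contractions b"
  obtains T :: "'h \<Rightarrow>\<^sub>L 'h" where "T \<in> bounded_ops" "norm T \<le> 1"
    "\<And>v. (\<lambda>n. cinner v (a n) *\<^sub>C b n) sums T v"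
proof -
  have summ: "summable (\<lambda>n. (cmod (cinner v (a n)))\<^sup>2)" for v
    by (rule bounded_imp_summable[where B = "(norm v)\<^sup>2"])
      (use Bessel_inequality[OF a] in auto)
  have conv: "summable (\<lambda>n. cinner v (a n) *\<^sub>C b n)" for v
    unfolding summable_Cauchy
  proof (intro allI impI)
    fix \<epsilon> :: real assume e: "\<epsilon> > 0"
    then obtain N where N: "\<And>m n. m \<ge> N \<Longrightarrow>
        norm (\<Sum>k=m..<n. (cmod (cinner v (a k)))\<^sup>2) < \<epsilon>\<^sup>2"
      using summ[of v] unfolding summable_Cauchy by (metis zero_less_power)
    have "norm (\<Sum>k=m..<n. cinner v (a k) *\<^sub>C b k) < \<epsilon>" if "m \<ge> N" for m n
    proof (rule power2_less_imp_less)
      have "(norm (\<Sum>k=m..<n. cinner v (a k) *\<^sub>C b k))\<^sup>2 \<le> (\<Sum>k=m..<n. (cmod (cinner v (a k)))\<^sup>2)"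
        by (rule norm_orthogonal_sum_square_le[OF b]) simp
      also have "\<dots> < \<epsilon>\<^sup>2" using N[OF that, of n] by simp
      finally show "(norm (\<Sum>k=m..<n. cinner v (a k) *\<^sub>C b k))\<^sup>2 < \<epsilon>\<^sup>2" .
    qed (use e in simp)
    then show "\<exists>N. \<forall>m\<ge>N. \<forall>n. norm (\<Sum>k=m..<n. cinner v (a k) *\<^sub>C b k) < \<epsilon>" by blast
  qed
  define f where "f v = (\<Sum>n. cinner v (a n) *\<^sub>C b n)" for v
  have f: "(\<lambda>n. cinner v (a n) *\<^sub>C b n) sums f v" for v
    unfolding f_def by (rule summable_sums[OF conv])
  have bound: "norm (f v) \<le> 1 * norm v" for v
  proof -
    have "norm (\<Sum>n<N. cinner v (a n) *\<^sub>C b n) \<le> norm v" for N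
    proof (rule power2_le_imp_le)
      show "(norm (\<Sum>n<N. cinner v (a n) *\<^sub>C b n))\<^sup>2 \<le> (norm v)\<^sup>2"
        by (rule order_trans[OF norm_orthogonal_sum_square_le[OF b] Bessel_inequality[OF a]]) simp_all
    qed simp
    then show ?thesis
      using tendsto_norm[OF f[of v, unfolded sums_def]] by (auto intro: LIMSEQ_le_const2)
  qed
  have add: "f (x + y) = f x + f y" for x y
    using sums_add[OF f[of x] f[of y]] f[of "x + y"]
    by (auto simp: cinner_add_left scaleC_add_left intro: sums_unique2)
  have scale: "f (c *\<^sub>C x) = c *\<^sub>C f x" for c x
    using bounded_linear.sums[OF bounded_linear_scaleC f[of x], of c] f[of "c *\<^sub>C x"]
    by (auto simp: cinner_scaleC_left intro: sums_unique2)
  obtain T :: "'h \<Rightarrow>\<^sub>L 'h" where T: "T \<in> bounded_ops" "\<And>x. T x = f x"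
    using bounded_opsI[of f 1, OF add scale bound] by auto
  moreover have "norm T \<le> 1" by (rule norm_blinfun_bound) (use bound in \<open>auto simp: T\<close>)
  ultimately show ?thesis using that f by simp
qed

text \<open>Since \<open>sgn 0 = 0\<close>, a vector \<open>d n\<close> in the span of its
  predecessors produces 0 and does no harm later.\<close>

function gram_schmidt :: "(nat \<Rightarrow> 'h::complex_hilbert_space) \<Rightarrow> nat \<Rightarrow> 'h" where
  "gram_schmidt d n =
    sgn (d n - (\<Sum>i\<in>{..<n}. cinner (d n) (gram_schmidt d i) *\<^sub>C gram_schmidt d i))"
  by auto
termination by (relation "Wellfounded.measure snd") auto

declare gram_schmidt.simps [simp del]

lemma gram_schmidt_step:
  "gram_schmidt d n = sgn (d n - (\<Sum>i<n. cinner (d n) (gram_schmidt d i) *\<^sub>C gram_schmidt d i))"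
  by (rule gram_schmidt.simps)

lemma norm_gram_schmidt: "norm (gram_schmidt d n) = (if gram_schmidt d n = 0 then 0 else 1)"
  unfolding gram_schmidt_step[of d n] by (simp add: norm_sgn sgn_zero_iff)

lemma gram_schmidt_orthogonal:
  fixes d :: "nat \<Rightarrow> 'h::complex_hilbert_space"
  shows "i < n \<Longrightarrow> cinner (gram_schmidt d n) (gram_schmidt d i) = 0"
proof (induction n arbitrary: i rule: less_induct)
  case (less n)
  let ?e = "gram_schmidt d"
  have "cinner (?e j) (?e i) = 0" if "j < n" "j \<noteq> i" for j
  proof (cases "i < j")
    case True
    then show ?thesis using less.IH[of j i] that by blast
  next
    case False
    then have "cinner (?e i) (?e j) = 0" using less.IH[of i j] that less.prems by simp
    then show ?thesis by (simp add: cinner_eq_0_commute)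
  qed
  then have "(\<Sum>j<n. cinner (d n) (?e j) * cinner (?e j) (?e i))
      = (\<Sum>j<n. if j = i then cinner (d n) (?e i) * cinner (?e i) (?e i) else 0)"
    by (intro sum.cong) auto
  also have "\<dots> = cinner (d n) (?e i) * cinner (?e i) (?e i)" using less.prems by simp
  \<comment> \<open>If \<open>?e i\<close> is zero both sides vanish; otherwise it is a unit
    vector.\<close>
  also have "\<dots> = cinner (d n) (?e i)"
    using norm_gram_schmidt[of d i] by (cases "?e i = 0") (simp_all add: cinner_self)
  finally have "cinner (d n - (\<Sum>j<n. cinner (d n) (?e j) *\<^sub>C ?e j)) (?e i) = 0"
    by (simp add: cinner.diff_left cinner.sum_left cinner_scaleC_left)
  then show ?case
    unfolding gram_schmidt_step[of d n] by (simp add: sgn_div_norm cinner.scaleR_left)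
qed

lemma orthogonal_contractions_gram_schmidt: "orthogonal_contractions (gram_schmidt d)"
  unfolding orthogonal_contractions_def
proof (intro conjI allI impI)
  show "cinner (gram_schmidt d m) (gram_schmidt d n) = 0" if "m \<noteq> n" for m n
    using that gram_schmidt_orthogonal[of m n d] gram_schmidt_orthogonal[of n m d]
    by (cases m n rule: linorder_cases) (auto simp: cinner_eq_0_commute)
  show "norm (gram_schmidt d n) \<le> 1" for n
    by (simp add: norm_gram_schmidt)
qed

text \<open>The series terminates: the terms below \<open>n\<close> add up to the part subtracted
  from \<open>d n\<close>, term \<open>n\<close> is the remainder \<open>v\<close>, and all later
  terms are zero.\<close>

lemma gram_schmidt_expansion:
  fixes d :: "nat \<Rightarrow> 'h::complex_hilbert_space"
  shows "(\<lambda>k. cinner (d n) (gram_schmidt d k) *\<^sub>C gram_schmidt d k) sums d n"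
proof -
  let ?e = "gram_schmidt d"
  define v where "v = d n - (\<Sum>i<n. cinner (d n) (?e i) *\<^sub>C ?e i)"
  have e: "?e n = sgn v" unfolding v_def by (rule gram_schmidt_step)
  have v: "v = norm v *\<^sub>R ?e n"
    unfolding e by (cases "v = 0") (simp_all add: sgn_div_norm)
  have d: "d n = norm v *\<^sub>R ?e n + (\<Sum>i<n. cinner (d n) (?e i) *\<^sub>C ?e i)"
    using v by (simp add: v_def)
  have orth: "cinner (?e i) (?e j) = 0" if "i \<noteq> j" for i j
    using orthogonal_contractions_gram_schmidt that by (auto simp: orthogonal_contractions_def)
  have zero: "cinner (d n) (?e k) = 0" if "k > n" for k
    by (subst d, simp add: cinner_add_left cinner.sum_left cinner.scaleR_left cinner_scaleC_left)
      (use orth that in auto)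
  have last: "cinner (d n) (?e n) *\<^sub>C ?e n = v"
  proof (cases "v = 0")
    case True
    then show ?thesis by (simp add: e)
  next
    case False
    then have "norm (?e n) = 1"
      by (simp add: e norm_sgn)
    then have "cinner (d n) (?e n) = complex_of_real (norm v)"
      by (subst d, simp add: cinner_add_left cinner.sum_left cinner.scaleR_left cinner_scaleC_left
        cinner_self orth scaleR_conv_of_real)
    then show ?thesis using v by (simp add: scaleR_scaleC[where 'a = 'h])
  qed
  have "(\<lambda>k. cinner (d n) (?e k) *\<^sub>C ?e k) sums (\<Sum>k\<in>{..n}. cinner (d n) (?e k) *\<^sub>C ?e k)"
    by (rule sums_finite) (use zero in auto)
  also have "(\<Sum>k\<in>{..n}. cinner (d n) (?e k) *\<^sub>C ?e k) = d n"
    by (simp add: lessThan_Suc_atMost[symmetric] last) (simp add: v_def)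
  finally show ?thesis .
qed

text \<open>Orthogonalising a dense sequence \<open>d\<close>, the operator \<open>T\<close> that
  sums the expansions is continuous and fixes every \<open>d n\<close>, hence is the
  identity.\<close>

lemma separable_orthogonal_basis:
  assumes "separable_space (euclidean :: 'h::complex_hilbert_space topology)"
  obtains e :: "nat \<Rightarrow> 'h::complex_hilbert_space" where "orthogonal_contractions e"
    "\<And>v. (\<lambda>k. cinner v (e k) *\<^sub>C e k) sums v"
proof -
  obtain C :: "'h set" where C: "countable C" "closure C = UNIV"
    using assms unfolding separable_space_def by auto
  have "C \<noteq> {}" using C(2) by auto
  then obtain d where d: "C = range (d :: nat \<Rightarrow> 'h)"
    using C(1) by (metis range_from_nat_into)
  let ?e = "gram_schmidt d"
  obtain T :: "'h \<Rightarrow>\<^sub>L 'h" where T: "\<And>v. (\<lambda>n. cinner v (?e n) *\<^sub>C ?e n) sums T v"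
    using orthogonal_operator[of ?e ?e] orthogonal_contractions_gram_schmidt by metis
  have "closed {v. T v = v}"
    by (intro closed_Collect_eq continuous_intros)
  moreover have "T (d n) = d n" for n
    using T gram_schmidt_expansion sums_unique2 by blast
  ultimately have "closure C \<subseteq> {v. T v = v}"
    using d by (intro closure_minimal) auto
  then have "T v = v" for v using C(2) by auto
  then show ?thesis using that[of ?e] T orthogonal_contractions_gram_schmidt by metis
qed

subsection \<open>Ideals are closed under adjoints\<close>

lemma norm_adj_le:
  fixes A :: "'h::complex_hilbert_space \<Rightarrow>\<^sub>L 'h"
  assumes A: "A \<in> bounded_ops"
  shows "norm (adj A) \<le> norm A"
proof (rule norm_blinfun_bound)
  fix y
  have "(norm (adj A y))\<^sup>2 = cmod (cinner (A (adj A y)) y)"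
    by (simp add: cinner_adj[OF A] cinner_self norm_power)
  also have "\<dots> \<le> norm (A (adj A y)) * norm y" by (rule Cauchy_Schwarz_cinner)
  also have "\<dots> \<le> norm A * norm (adj A y) * norm y" by (intro mult_right_mono norm_blinfun) simp
  finally have "norm (adj A y) * norm (adj A y) \<le> norm (adj A y) * (norm A * norm y)"
    by (simp add: power2_eq_square mult_ac)
  then show "norm (adj A y) \<le> norm A * norm y"
    by (cases "adj A y = 0") (auto simp: mult_le_cancel_left)
qed simp

text \<open>
  The square root \<open>S = 1 - Y\<close> of \<open>A\<^sup>*A = 1 - X\<close>: the iteration \<open>Y \<mapsto> (X + Y\<^sup>2)/2\<close> converges because
  its increments are dominated by those of the scalar iteration \<open>y \<mapsto> (1 + y\<^sup>2)/2\<close>.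
\<close>

lemma contraction_absolute_value:
  fixes A :: "'h::complex_hilbert_space \<Rightarrow>\<^sub>L 'h"
  assumes A: "A \<in> bounded_ops" and norm_A: "norm A \<le> 1"
  obtains S :: "'h \<Rightarrow>\<^sub>L 'h" where "S \<in> bounded_ops"
    "\<And>x y. cinner (S x) y = cinner x (S y)" "\<And>x. norm (S x) = norm (A x)"
proof -
  have contr: "norm (A x) \<le> norm x" "norm (adj A x) \<le> norm x" for x
    using norm_blinfun[of A x] norm_blinfun[of "adj A" x] norm_A norm_adj_le[OF A]
      mult_right_mono[of "norm A" 1 "norm x"] mult_right_mono[of "norm (adj A)" 1 "norm x"]
    by auto
  define X where "X = id_blinfun - (adj A o\<^sub>L A)"
  have X: "X \<in> bounded_ops"
    unfolding X_def by (intro bounded_ops_diff bounded_ops_id bounded_ops_compose bounded_ops_adj A)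
  have X_apply: "X u = u - adj A (A u)" for u by (simp add: X_def blinfun.diff_left)
  have X_sym: "cinner (X u) v = cinner u (X v)" for u v
    by (simp add: X_apply cinner.diff_left cinner.diff_right cinner_adj_left[OF A] cinner_adj[OF A])
  have norm_X: "norm X \<le> 1"
  proof (rule norm_blinfun_bound)
    fix u
    have "(norm (X u))\<^sup>2 = (norm u)\<^sup>2 - 2 * (norm (A u))\<^sup>2 + (norm (adj A (A u)))\<^sup>2"
      by (simp add: X_apply norm_diff_square cinner_adj[OF A, symmetric] cinner_self)
    also have "(norm (adj A (A u)))\<^sup>2 \<le> (norm (A u))\<^sup>2" by (intro power_mono contr) simp
    finally have "(norm (X u))\<^sup>2 \<le> (norm u)\<^sup>2" using zero_le_power2[of "norm (A u)"] by linarith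
    then show "norm (X u) \<le> 1 * norm u" by (simp add: power2_le_iff_abs_le)
  qed simp
  define Y where "Y = rec_nat 0 (\<lambda>_ Z. (1/2) *\<^sub>R (X + (Z o\<^sub>L Z)))"
  have Y0: "Y 0 = 0" and YSuc: "Y (Suc n) = (1/2) *\<^sub>R (X + (Y n o\<^sub>L Y n))" for n
    by (simp_all add: Y_def)
  define y :: "nat \<Rightarrow> real" where "y = rec_nat 0 (\<lambda>_ z. (1 + z\<^sup>2) / 2)"
  have y0: "y 0 = 0" and ySuc: "y (Suc n) = (1 + (y n)\<^sup>2) / 2" for n
    by (simp_all add: y_def)
  have y_range: "0 \<le> y n \<and> y n \<le> 1" for n
    by (induction n) (auto simp: y0 ySuc power_le_one)
  have norm_Y: "norm (Y n) \<le> y n" for n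
  proof (induction n)
    case (Suc n)
    have "norm (Y n o\<^sub>L Y n) \<le> y n * y n"
      using norm_blinfun_compose[of "Y n" "Y n"] mult_mono[OF Suc Suc] y_range[of n] by fastforce
    then have "norm (X + (Y n o\<^sub>L Y n)) \<le> 1 + y n * y n"
      using norm_triangle_ineq[of X "Y n o\<^sub>L Y n"] norm_X by linarith
    then show ?case by (simp add: YSuc ySuc power2_eq_square)
  qed (simp add: Y0 y0)
  have step: "norm (Y (Suc n) - Y n) \<le> y (Suc n) - y n" for n
  proof (induction n)
    case 0
    show ?case using norm_X by (simp add: Y0 y0 YSuc ySuc)
  next
    case (Suc n)
    let ?D = "Y (Suc n) - Y n"
    \<comment> \<open>This way of splitting a difference of two squares is valid without
      commutation.\<close>
    have "Y (Suc (Suc n)) - Y (Suc n) = (1/2) *\<^sub>R ((Y (Suc n) o\<^sub>L ?D) + (?D o\<^sub>L Y n))"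
      by (rule blinfun_eqI)
        (subst YSuc[of "Suc n"], subst (2) YSuc[of n],
         simp add: blinfun.bilinear_simps scaleR_diff_right scaleR_add_right)
    moreover have "norm (Y (Suc n) o\<^sub>L ?D) \<le> y (Suc n) * (y (Suc n) - y n)"
      using norm_blinfun_compose[of "Y (Suc n)" ?D] mult_mono[OF norm_Y[of "Suc n"] Suc] y_range[of "Suc n"]
      by fastforce
    moreover have "norm (?D o\<^sub>L Y n) \<le> (y (Suc n) - y n) * y n"
      using norm_blinfun_compose[of ?D "Y n"] mult_mono[OF Suc norm_Y[of n]] Suc
        order_trans[OF norm_ge_zero Suc] by fastforce
    ultimately have "norm (Y (Suc (Suc n)) - Y (Suc n))
        \<le> (y (Suc n) * (y (Suc n) - y n) + (y (Suc n) - y n) * y n) / 2"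
      using norm_triangle_ineq[of "Y (Suc n) o\<^sub>L ?D" "?D o\<^sub>L Y n"] by simp
    also have "\<dots> = y (Suc (Suc n)) - y (Suc n)"
      by (subst ySuc[of "Suc n"], subst (4) ySuc[of n]) (simp add: power2_eq_square field_simps)
    finally show ?case .
  qed
  have y_mono: "y n \<le> y (Suc n)" for n using step[of n] norm_ge_zero[of "Y (Suc n) - Y n"] by linarith
  obtain l where "y \<longlonglongrightarrow> l"
    using incseq_convergent[of y 1] y_mono y_range unfolding incseq_Suc_iff by metis
  then have "summable (\<lambda>n. y (Suc n) - y n)" using telescope_summable by blast
  then have "summable (\<lambda>n. Y (Suc n) - Y n)"
    by (rule summable_comparison_test') (use step in auto)
  then have "convergent (\<lambda>n. \<Sum>k<n. Y (Suc k) - Y k)"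
    by (simp add: summable_iff_convergent)
  then obtain Z where Z: "Y \<longlonglongrightarrow> Z"
    by (auto simp: sum_lessThan_telescope Y0 convergent_def)
  have Y_ops: "Y n \<in> bounded_ops" for n
    by (induction n) (auto simp: Y0 YSuc bounded_ops_def blinfun.bilinear_simps scaleC_add_right
      scaleR_scaleC mult.commute bounded_ops_scaleC[OF X])
  have Y_sym: "cinner (Y n u) v = cinner u (Y n v)" for n u v
    by (induction n arbitrary: u v)
      (auto simp: Y0 YSuc blinfun.bilinear_simps cinner_add_left cinner_add_right X_sym
        cinner.scaleR_left cinner.scaleR_right)
  have Z_ops: "Z \<in> bounded_ops" by (rule bounded_ops_lim[OF Y_ops Z])
  have Z_sym: "cinner (Z u) v = cinner u (Z v)" for u v
  proof (rule LIMSEQ_unique)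
    show "(\<lambda>n. cinner (Y n u) v) \<longlonglongrightarrow> cinner (Z u) v"
      by (intro cinner.tendsto blinfun.tendsto Z tendsto_const)
    show "(\<lambda>n. cinner (Y n u) v) \<longlonglongrightarrow> cinner u (Z v)"
      unfolding Y_sym by (intro cinner.tendsto blinfun.tendsto Z tendsto_const)
  qed
  have Z_eq: "Z = (1/2) *\<^sub>R (X + (Z o\<^sub>L Z))"
  proof (rule LIMSEQ_unique)
    show "(\<lambda>n. Y (Suc n)) \<longlonglongrightarrow> Z" using Z by (simp add: LIMSEQ_Suc)
    show "(\<lambda>n. Y (Suc n)) \<longlonglongrightarrow> (1/2) *\<^sub>R (X + (Z o\<^sub>L Z))"
      unfolding YSuc
      by (intro tendsto_intros bounded_bilinear.tendsto[OF bounded_bilinear_blinfun_compose] Z)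
  qed
  define S where "S = id_blinfun - Z"
  have S_apply: "S u = u - Z u" for u by (simp add: S_def blinfun.diff_left)
  have S_ops: "S \<in> bounded_ops" unfolding S_def by (intro bounded_ops_diff bounded_ops_id Z_ops)
  have S_sym: "cinner (S u) v = cinner u (S v)" for u v
    by (simp add: S_apply cinner.diff_left cinner.diff_right Z_sym)
  have "norm (S u) = norm (A u)" for u
  proof -
    \<comment> \<open>The fixed point equation rearranges to \<open>(1 - Z)\<^sup>2 = 1 - X\<close>,
      and \<open>1 - X\<close> is \<open>adj A\<close> after \<open>A\<close>.\<close>
    have "2 *\<^sub>R Z u = X u + Z (Z u)"
      by (subst Z_eq) (simp add: blinfun.bilinear_simps)
    then have "S (S u) = adj A (A u)"
      by (simp add: S_apply X_apply blinfun.diff_right scaleR_2 algebra_simps)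
    then have "cinner (S u) (S u) = cinner (A u) (A u)"
      by (simp add: S_sym cinner_adj[OF A])
    then have "(norm (S u))\<^sup>2 = (norm (A u))\<^sup>2" unfolding cinner_self of_real_eq_iff .
    then show ?thesis by simp
  qed
  then show ?thesis using that S_ops S_sym by blast
qed

lemma operator_idealD:
  assumes "operator_ideal I"
  shows "A \<in> I \<Longrightarrow> A \<in> bounded_ops"
    and "A \<in> I \<Longrightarrow> B \<in> I \<Longrightarrow> A + B \<in> I"
    and "A \<in> I \<Longrightarrow> scale_op c A \<in> I"
    and "A \<in> I \<Longrightarrow> B \<in> bounded_ops \<Longrightarrow> A o\<^sub>L B \<in> I"
    and "A \<in> I \<Longrightarrow> B \<in> bounded_ops \<Longrightarrow> B o\<^sub>L A \<in> I"
  using assms unfolding operator_ideal_def by auto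

text \<open>
  With \<open>S\<close> a positive multiple of the absolute value of \<open>A\<close>, Douglas' lemma gives \<open>A\<^sup>* = S T\<close> and
  \<open>S = T'\<^sup>* A\<close>.
\<close>

lemma operator_ideal_adj:
  fixes A :: "'h::complex_hilbert_space \<Rightarrow>\<^sub>L 'h"
  assumes I: "operator_ideal I" and "A \<in> I"
  shows "adj A \<in> I"
proof -
  have A: "A \<in> bounded_ops" using assms by (auto simp: operator_ideal_def)
  \<comment> \<open>Scaling turns \<open>A\<close> into a contraction; the summand 1 keeps the
    denominator positive when \<open>A = 0\<close>.\<close>
  define c where "c = 1 / (norm A + 1)"
  have "norm A + 1 > 0" by (simp add: add_nonneg_pos)
  then have c: "c > 0" "norm (c *\<^sub>R A) \<le> 1" by (simp_all add: c_def)
  obtain S :: "'h \<Rightarrow>\<^sub>L 'h" where S: "S \<in> bounded_ops"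
      "\<And>x y. cinner (S x) y = cinner x (S y)" "\<And>x. norm (S x) = norm ((c *\<^sub>R A) x)"
    using contraction_absolute_value[OF bounded_ops_scaleR[OF A] c(2)] by blast
  have norm_S: "norm (S x) = c * norm (A x)" for x
    using c(1) by (simp add: S(3) blinfun.scaleR_left)
  obtain T where T: "T \<in> bounded_ops" "\<And>x y. cinner (A x) y = cinner (S x) (blinfun_apply T y)"
    using Douglas_factorization[OF A S(1), of "1/c"] c(1) norm_S by auto
  obtain T' where T': "T' \<in> bounded_ops" "\<And>x y. cinner (S x) y = cinner (A x) (blinfun_apply T' y)"
    using Douglas_factorization[OF S(1) A, of c] c(1) norm_S by auto
  have S_eq: "S x = adj T' (A x)" for x
    by (rule cinner_eq_left) (simp add: T'(2) cinner_adj_left[OF T'(1)])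
  have "adj A = adj T' o\<^sub>L (A o\<^sub>L T)"
    by (intro adj_eqI bounded_ops_compose bounded_ops_adj T T' A)
      (simp add: T(2) S(2) flip: S_eq)
  then show ?thesis
    using operator_idealD[OF I] \<open>A \<in> I\<close> T T' bounded_ops_adj by metis
qed

subsection \<open>Compact operators\<close>

text \<open>Gaussian elimination: an equation with a nonzero coefficient is solved for its pivot
  unknown \<open>p\<close> and substituted into the others, while a trivial equation is
  dropped.\<close>

lemma homogeneous_system_nontrivial_solution:
  fixes a :: "'j \<Rightarrow> 'k \<Rightarrow> 'f::field"
  assumes "finite J" "finite K" "card J < card K"
  shows "\<exists>c. (\<exists>i\<in>K. c i \<noteq> 0) \<and> (\<forall>j\<in>J. (\<Sum>i\<in>K. c i * a j i) = 0)"
  using assms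
proof (induction J arbitrary: K a rule: finite_induct)
  case empty
  then have "K \<noteq> {}" by auto
  then show ?case by (intro exI[of _ "\<lambda>_. 1"]) auto
next
  case (insert j J)
  show ?case
  proof (cases "\<forall>i\<in>K. a j i = 0")
    case True
    have "card J < card K" using insert by simp
    then obtain c where "\<exists>i\<in>K. c i \<noteq> 0" "\<forall>j\<in>J. (\<Sum>i\<in>K. c i * a j i) = 0"
      using insert.IH[OF insert.prems(1), of a] by blast
    then show ?thesis using True by (intro exI[of _ c]) simp
  next
    case False
    then obtain p where p: "p \<in> K" "a j p \<noteq> 0" by blast
    define L where "L = K - {p}"
    have L: "finite L" "p \<notin> L" "K = insert p L" using p insert.prems by (auto simp: L_def)
    have "card J < card L" using insert L by simp
    then obtain c where c: "\<exists>i\<in>L. c i \<noteq> 0"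
        "\<forall>k\<in>J. (\<Sum>i\<in>L. c i * (a k i - a k p * a j i / a j p)) = 0"
      using insert.IH[OF L(1), of "\<lambda>k i. a k i - a k p * a j i / a j p"] by blast
    define t where "t = - (\<Sum>i\<in>L. c i * a j i) / a j p"
    define d where "d = c(p := t)"
    have d: "(\<Sum>i\<in>K. d i * a k i) = t * a k p + (\<Sum>i\<in>L. c i * a k i)" for k
    proof -
      have "(\<Sum>i\<in>L. d i * a k i) = (\<Sum>i\<in>L. c i * a k i)"
        using L by (intro sum.cong) (auto simp: d_def)
      then show ?thesis using L by (simp add: d_def)
    qed
    have "(\<Sum>i\<in>K. d i * a k i) = 0" if "k \<in> J" for k
    proof -
      have "0 = (\<Sum>i\<in>L. c i * a k i - c i * a j i * (a k p / a j p))"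
        using bspec[OF c(2) that] by (simp add: algebra_simps)
      also have "\<dots> = (\<Sum>i\<in>L. c i * a k i) - (\<Sum>i\<in>L. c i * a j i) * (a k p / a j p)"
        by (simp only: sum_subtractf sum_distrib_right)
      finally show ?thesis unfolding d t_def using p by (simp add: field_simps)
    qed
    moreover have "(\<Sum>i\<in>K. d i * a j i) = 0" unfolding d t_def using p by simp
    moreover have "\<exists>i\<in>K. d i \<noteq> 0" using c(1) L by (auto simp: d_def)
    ultimately show ?thesis by (intro exI[of _ d]) auto
  qed
qed

text \<open>Equivalent to compactness of a bounded operator on a Hilbert space.\<close>

definition compact_operator :: "('h::complex_hilbert_space \<Rightarrow>\<^sub>L 'h) \<Rightarrow> bool"
  where "compact_operator A \<longleftrightarrow> (\<forall>s>0. \<exists>F. finite F \<and>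
    (\<forall>v. (\<forall>x\<in>F. cinner v x = 0) \<longrightarrow> norm (A v) \<le> s * norm v))"

text \<open>For compact \<open>A\<close>: at least \<open>k\<close> singular values of \<open>A\<close> are \<open>\<ge> s\<close>.\<close>

definition bounded_below_on_frame :: "('h::complex_hilbert_space \<Rightarrow>\<^sub>L 'h) \<Rightarrow> real \<Rightarrow> nat \<Rightarrow> bool"
  where "bounded_below_on_frame A s k \<longleftrightarrow>
    (\<exists>b. (\<forall>i<k. \<forall>j<k. cinner (b i) (b j) = (if i = j then 1 else 0)) \<and>
      (\<forall>c. s * norm (\<Sum>i<k. c i *\<^sub>C b i) \<le> norm (A (\<Sum>i<k. c i *\<^sub>C b i))))"

lemma cinner_frame_sum:
  assumes "\<forall>i<k. \<forall>j<k. cinner (b i) (b j) = (if i = j then 1 else 0)" "i < (k::nat)"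
  shows "cinner (\<Sum>j<k. c j *\<^sub>C b j) (b i) = c i"
proof -
  have "cinner (\<Sum>j<k. c j *\<^sub>C b j) (b i) = (\<Sum>j<k. if j = i then c i else 0)"
    unfolding cinner.sum_left
    using assms by (intro sum.cong) (auto simp: cinner_scaleC_left)
  then show ?thesis using assms(2) by simp
qed

text \<open>A frame with more than \<open>card F\<close> vectors has a nonzero combination
  orthogonal to \<open>F\<close>. There compactness, applied with \<open>s / 2\<close>, contradicts
  the lower bound \<open>s\<close>.\<close>

lemma compact_frame_bound:
  fixes A :: "'h::complex_hilbert_space \<Rightarrow>\<^sub>L 'h"
  assumes "compact_operator A" "s > 0"
  obtains N where "\<And>k. bounded_below_on_frame A s k \<Longrightarrow> k \<le> N"
proof -
  have "s / 2 > 0" using assms(2) by simp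
  then obtain F where F: "finite F"
      "\<And>v. (\<forall>x\<in>F. cinner v x = 0) \<Longrightarrow> norm (A v) \<le> s / 2 * norm v"
    using assms(1) unfolding compact_operator_def by blast
  have "k \<le> card F" if frame: "bounded_below_on_frame A s k" for k
  proof (rule ccontr)
    assume "\<not> k \<le> card F"
    then have "card F < card {..<k}" by simp
    obtain b where b: "\<forall>i<k. \<forall>j<k. cinner (b i) (b j) = (if i = j then 1 else 0)"
        "\<And>c. s * norm (\<Sum>i<k. c i *\<^sub>C b i) \<le> norm (A (\<Sum>i<k. c i *\<^sub>C b i))"
      using frame unfolding bounded_below_on_frame_def by blast
    obtain c where c: "\<exists>i\<in>{..<k}. c i \<noteq> 0" "\<forall>x\<in>F. (\<Sum>i<k. c i * cinner (b i) x) = 0"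
      using homogeneous_system_nontrivial_solution[OF F(1) _ \<open>card F < card {..<k}\<close>,
          of "\<lambda>x i. cinner (b i) x"] by auto
    define v where "v = (\<Sum>i<k. c i *\<^sub>C b i)"
    have "\<forall>x\<in>F. cinner v x = 0"
      using c(2) by (simp add: v_def cinner.sum_left cinner_scaleC_left)
    then have "s * norm v \<le> s / 2 * norm v" using F(2)[of v] b(2)[of c] by (simp add: v_def)
    then have "v = 0" using assms(2) by (simp add: mult_le_cancel_right)
    moreover obtain i where "i < k" "c i \<noteq> 0" using c(1) by auto
    ultimately show False using cinner_frame_sum[OF b(1), of i c] by (simp add: v_def)
  qed
  then show ?thesis using that by blast
qed

subsection \<open>Rank one operators and automorphisms\<close>

text \<open>This is the operator written \<open>x \<otimes> y\<close> in the remarks.\<close>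

definition rank_one :: "'h \<Rightarrow> 'h \<Rightarrow> ('h::complex_hilbert_space \<Rightarrow>\<^sub>L 'h)"
  where "rank_one x y = Blinfun (\<lambda>z. cinner z y *\<^sub>C x)"

lemma rank_one_apply [simp]: "rank_one x y z = cinner z y *\<^sub>C x"
  unfolding rank_one_def
  by (subst bounded_linear_Blinfun_apply)
    (auto intro: bounded_linear_compose[OF scaleC.bounded_linear_left cinner.bounded_linear_left])

lemma bounded_ops_rank_one: "rank_one x y \<in> bounded_ops"
  by (simp add: bounded_ops_def cinner_scaleC_left)

lemma adj_rank_one: "adj (rank_one x y) = rank_one y x"
proof (rule adj_eqI[OF bounded_ops_rank_one])
  fix u v show "cinner (rank_one x y u) v = cinner u (rank_one y x v)"
    by (simp add: cinner_scaleC_left cinner_scaleC_right mult.commute)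
      (metis cinner_commute)
qed

lemma norm_rank_one_le: "norm (rank_one x y) \<le> norm x * norm y"
proof (rule norm_blinfun_bound)
  show "norm (rank_one x y z) \<le> norm x * norm y * norm z" for z
    using mult_right_mono[OF Cauchy_Schwarz_cinner[of z y] norm_ge_zero[of x]]
    by (simp add: norm_scaleC mult_ac)
qed simp

lemma compose_rank_one:
  "B \<in> bounded_ops \<Longrightarrow> B o\<^sub>L rank_one x y = rank_one (blinfun_apply B x) y"
  by (rule blinfun_eqI) (simp add: bounded_ops_scaleC)

lemma rank_one_compose: "B \<in> bounded_ops \<Longrightarrow> rank_one x y o\<^sub>L B = rank_one x (adj B y)"
  by (rule blinfun_eqI) (simp add: cinner_adj)

lemma rank_one_rank_one: "rank_one x y o\<^sub>L rank_one z w = rank_one (cinner z y *\<^sub>C x) w"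
  by (rule blinfun_eqI) (simp add: cinner_scaleC_left)

lemma scale_op_rank_one: "scale_op c (rank_one x y) = rank_one (c *\<^sub>C x) y"
  by (rule blinfun_eqI) (simp add: scale_op_apply mult.commute)

text \<open>Sandwiching \<open>A\<close> between \<open>rank_one x (A v)\<close> and
  \<open>rank_one v y\<close>, where \<open>A v \<noteq> 0\<close>, yields a nonzero multiple of the
  desired operator.\<close>

lemma operator_ideal_rank_one:
  fixes I :: "('h::complex_hilbert_space \<Rightarrow>\<^sub>L 'h) set"
  assumes I: "operator_ideal I" and "A \<in> I" "A \<noteq> 0"
  shows "rank_one x y \<in> I"
proof -
  obtain v where v: "A v \<noteq> 0" using \<open>A \<noteq> 0\<close> by (metis blinfun_eqI zero_blinfun.rep_eq)
  have "rank_one x (A v) o\<^sub>L (A o\<^sub>L rank_one v y) \<in> I"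
    using operator_idealD[OF I] \<open>A \<in> I\<close> bounded_ops_rank_one by metis
  then have "scale_op (1 / cinner (A v) (A v)) (rank_one x (A v) o\<^sub>L (A o\<^sub>L rank_one v y)) \<in> I"
    by (rule operator_idealD[OF I])
  moreover have "scale_op (1 / cinner (A v) (A v)) (rank_one x (A v) o\<^sub>L (A o\<^sub>L rank_one v y))
      = rank_one x y"
    using v operator_idealD(1)[OF I \<open>A \<in> I\<close>]
    by (simp add: compose_rank_one rank_one_rank_one scale_op_rank_one cinner_self)
  ultimately show ?thesis by simp
qed

section \<open>Isometries and the spatial form of automorphisms\<close>

lemma linear_isometry_cinner:
  assumes "linear_isometry U"
  shows "cinner (U x) (U y) = cinner x (y :: 'h::complex_hilbert_space)"
proof -
  have Re_eq: "Re (cinner (U x) (U y)) = Re (cinner x y)" for x y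
    using norm_add_square[of "U x" "U y"] norm_add_square[of x y] assms
    by (simp add: linear_isometry_def flip: blinfun.add_right)
  show ?thesis
  proof (rule complex_eqI)
    show "Im (cinner (U x) (U y)) = Im (cinner x y)"
      using Re_eq[of "\<i> *\<^sub>C x" y] assms
      by (simp add: linear_isometry_def bounded_ops_scaleC cinner_scaleC_left)
  qed (rule Re_eq)
qed

text \<open>Linearity comes for free: the squared norm of \<open>u (x + y) - u x - u y\<close>
  expands into inner products of values of \<open>u\<close>, hence of the arguments, and these
  cancel. Homogeneity is the same computation.\<close>

lemma linear_isometryI:
  fixes u :: "'h::complex_hilbert_space \<Rightarrow> 'h"
  assumes u: "\<And>x y. cinner (u x) (u y) = cinner x y"
  obtains U where "linear_isometry U" "\<And>x. blinfun_apply U x = u x"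
proof -
  have eq0: "v = 0" if "cinner v v = 0" for v :: 'h using that by (simp add: cinner_self)
  have norm_u: "norm (u x) = norm x" for x
    using u[of x x] by (simp only: norm_eq_sqrt_cinner)
  obtain U :: "'h \<Rightarrow>\<^sub>L 'h" where "U \<in> bounded_ops" "\<And>x. U x = u x"
  proof (rule bounded_opsI[of u 1])
    show "u (x + y) = u x + u y" for x y
      using eq0[of "u (x + y) - u x - u y"]
      by (simp add: cinner.diff_left cinner.diff_right cinner_add_left cinner_add_right u)
        (simp add: algebra_simps)
    show "u (c *\<^sub>C x) = c *\<^sub>C u x" for c x
      using eq0[of "u (c *\<^sub>C x) - c *\<^sub>C u x"]
      by (simp add: cinner.diff_left cinner.diff_right cinner_scaleC_left cinner_scaleC_right u)
  qed (auto simp: norm_u)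
  then show ?thesis using that[of U] norm_u by (simp add: linear_isometry_def)
qed

text \<open>
  The candidate isometry is \<open>U x = \<phi>(x \<otimes> e) f\<close>; with \<open>W y = \<phi>(e \<otimes> y)\<^sup>* f\<close>, multiplicativity gives
  \<open>\<langle>U x, W y\<rangle> = \<langle>x, y\<rangle>\<close>, and the norm bounds force \<open>U = W\<close>.
\<close>

lemma multiplicative_intertwiner:
  fixes I :: "('h::complex_hilbert_space \<Rightarrow>\<^sub>L 'h) set"
  assumes I: "operator_ideal I" and rank_one: "\<And>x y. rank_one x y \<in> I"
    and maps: "\<phi> \<in> I \<rightarrow> bounded_ops" and mult: "multiplicative_on I \<phi>"
    and e: "norm e = 1" and f: "norm f = 1"
    and scalar: "\<And>c. \<phi> (rank_one (c *\<^sub>C e) e) f = c *\<^sub>C f"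
    and bound: "\<And>x. norm (\<phi> (rank_one x e) f) \<le> norm x"
    and bound': "\<And>y. norm (adj (\<phi> (rank_one e y)) f) \<le> norm y"
  obtains U where "linear_isometry U" "\<And>x. U x = \<phi> (rank_one x e) f"
    "\<And>A x. A \<in> I \<Longrightarrow> \<phi> A (U x) = U (blinfun_apply A x)"
    "\<And>A x. A \<in> I \<Longrightarrow> adj (\<phi> A) (U x) = U (adj A x)"
proof -
  define u where "u x = \<phi> (rank_one x e) f" for x
  define w where "w y = adj (\<phi> (rank_one e y)) f" for y
  have ops: "\<phi> A \<in> bounded_ops" if "A \<in> I" for A using maps that by blast
  have mult': "\<phi> (A o\<^sub>L B) = \<phi> A o\<^sub>L \<phi> B" if "A \<in> I" "B \<in> I" for A B
    using mult that by (simp add: multiplicative_on_def)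
  have uw: "cinner (u x) (w y) = cinner x y" for x y
  proof -
    \<comment> \<open>The product of the two rank one operators is a multiple of
      \<open>rank_one e e\<close>, so \<open>scalar\<close> is all the homogeneity that
      enters.\<close>
    have "cinner (u x) (w y) = cinner (\<phi> (rank_one e y o\<^sub>L rank_one x e) f) f"
      unfolding u_def w_def by (simp add: mult' rank_one cinner_adj ops)
    then show ?thesis
      by (simp add: rank_one_rank_one scalar cinner_scaleC_left cinner_self f)
  qed
  have "u x = w x" for x
  proof -
    have "(norm (u x - w x))\<^sup>2 = (norm (u x))\<^sup>2 - 2 * (norm x)\<^sup>2 + (norm (w x))\<^sup>2"
      by (simp add: norm_diff_square uw cinner_self)
    moreover have "(norm (u x))\<^sup>2 \<le> (norm x)\<^sup>2" "(norm (w x))\<^sup>2 \<le> (norm x)\<^sup>2"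
      unfolding u_def w_def by (intro power_mono bound bound' norm_ge_zero)+
    ultimately have "(norm (u x - w x))\<^sup>2 \<le> 0" by linarith
    then show ?thesis by simp
  qed
  then have wu: "w = u" by auto
  obtain U where U: "linear_isometry U" "\<And>x. blinfun_apply U x = u x"
    using linear_isometryI[of u] uw wu by auto
  show ?thesis
  proof (rule that[of U])
    show "\<phi> A (U x) = U (blinfun_apply A x)" if A: "A \<in> I" for A x
      unfolding U(2) u_def
      using mult'[OF A rank_one[of x e]] operator_idealD(1)[OF I A] by (simp add: compose_rank_one)
    show "adj (\<phi> A) (U x) = U (adj A x)" if A: "A \<in> I" for A x
    proof -
      \<comment> \<open>Multiplication from the right acts on the second slot of a rank one
        operator, through \<open>adj A\<close>. Hence the relation for adjoints comes out of
        \<open>w\<close>, without \<open>\<phi>\<close> being known to respect adjoints.\<close>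
      have "adj (\<phi> A) (w x) = adj (\<phi> (rank_one e x) o\<^sub>L \<phi> A) f"
        unfolding w_def by (simp add: adj_compose ops A rank_one)
      also have "\<dots> = w (adj A x)"
        unfolding w_def using mult'[OF rank_one[of e x] A] operator_idealD(1)[OF I A]
        by (simp add: rank_one_compose)
      finally show ?thesis by (simp add: U(2) wu)
    qed
  qed (use U in \<open>auto simp: u_def\<close>)
qed

lemma star_automorphismD:
  assumes "star_automorphism I \<Psi>"
  shows "A \<in> I \<Longrightarrow> \<Psi> A \<in> I"
    and "A \<in> I \<Longrightarrow> B \<in> I \<Longrightarrow> \<Psi> (A + B) = \<Psi> A + \<Psi> B"
    and "A \<in> I \<Longrightarrow> \<Psi> (scale_op c A) = scale_op c (\<Psi> A)"
    and "A \<in> I \<Longrightarrow> B \<in> I \<Longrightarrow> \<Psi> (A o\<^sub>L B) = \<Psi> A o\<^sub>L \<Psi> B"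
    and "A \<in> I \<Longrightarrow> \<Psi> (adj A) = adj (\<Psi> A)"
    and "bij_betw \<Psi> I I"
  using assms unfolding star_automorphism_def star_endomorphism_def multiplicative_on_def by auto

text \<open>Minimality is preserved: compressing any \<open>X\<close> by \<open>rank_one e e\<close>
  gives a scalar multiple of it, so compressing any element of \<open>I\<close> by \<open>G\<close>
  gives a multiple of \<open>G\<close>. Taking \<open>rank_one v g\<close> as that element forces
  \<open>G v\<close> onto the line of \<open>g\<close>, and self-adjointness of \<open>G\<close>
  fixes the coefficient.\<close>

lemma star_automorphism_rank_one_projection:
  fixes I :: "('h::complex_hilbert_space \<Rightarrow>\<^sub>L 'h) set"
  assumes I: "operator_ideal I" and rank_one: "\<And>x y. rank_one x y \<in> I"
    and \<Psi>: "star_automorphism I \<Psi>" and e: "norm e = 1"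
  obtains g where "norm g = 1" "\<Psi> (rank_one e e) = rank_one g g"
proof -
  note D = star_automorphismD[OF \<Psi>]
  define G where "G = \<Psi> (rank_one e e)"
  have "rank_one e e o\<^sub>L rank_one e e = rank_one e e"
    by (simp add: rank_one_rank_one cinner_self e)
  then have GG: "G o\<^sub>L G = G" unfolding G_def using D(4)[OF rank_one rank_one, of e e e e] by simp
  have G_adj: "adj G = G" unfolding G_def using D(5)[OF rank_one, of e e] by (simp add: adj_rank_one)
  have G_ops: "G \<in> bounded_ops" unfolding G_def using D(1) rank_one operator_idealD(1)[OF I] by blast
  have "rank_one e e \<noteq> 0"
  proof
    assume "rank_one e e = 0"
    then have "rank_one e e e = 0" by (simp only: zero_blinfun.rep_eq)
    then show False using e by (simp add: cinner_self)
  qed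
  moreover have zero: "0 \<in> I" using I by (simp add: operator_ideal_def)
  moreover have "scale_op 0 0 = (0 :: 'h \<Rightarrow>\<^sub>L 'h)" "scale_op 0 (\<Psi> 0) = 0"
    by (auto intro!: blinfun_eqI simp: scale_op_apply)
  then have "\<Psi> 0 = 0" using D(3)[OF zero, of 0] by simp
  ultimately have "G \<noteq> 0"
    unfolding G_def using D(6) rank_one by (metis bij_betw_imp_inj_on inj_on_eq_iff)
  then obtain z where z: "G z \<noteq> 0" by (metis blinfun_eqI zero_blinfun.rep_eq)
  define g where "g = sgn (G z)"
  have g: "norm g = 1" using z by (simp add: g_def norm_sgn)
  have "G (G z) = G z" using GG by (metis blinfun_apply_blinfun_compose)
  then have Gg: "G g = g" by (simp add: g_def sgn_div_norm blinfun.scaleR_right)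
  have "G v = cinner v g *\<^sub>C g" for v
  proof -
    obtain X where X: "X \<in> I" "\<Psi> X = rank_one v g"
      using D(6) rank_one[of v g] unfolding bij_betw_def by (metis imageE)
    have ops: "X \<in> bounded_ops" using X operator_idealD(1)[OF I] by blast
    have eX: "rank_one e e o\<^sub>L X \<in> I" using operator_idealD(4)[OF I] rank_one ops by blast
    have "(rank_one e e o\<^sub>L X) o\<^sub>L rank_one e e = scale_op (cinner (X e) e) (rank_one e e)"
      by (rule blinfun_eqI) (simp add: scale_op_apply bounded_ops_scaleC[OF ops] cinner_scaleC_left mult.commute)
    then have "(G o\<^sub>L rank_one v g) o\<^sub>L G = scale_op (cinner (X e) e) G"
      using D(4)[OF eX rank_one, of e e] D(4)[OF rank_one X(1), of e e] D(3)[OF rank_one, of _ e e] X(2)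
      by (simp add: G_def)
    then have "((G o\<^sub>L rank_one v g) o\<^sub>L G) g = (scale_op (cinner (X e) e) G) g" by simp
    then have Gv: "G v = cinner (X e) e *\<^sub>C g"
      by (simp add: Gg cinner_self g scale_op_apply)
    have "cinner (G v) g = cinner v g" using cinner_adj[OF G_ops, of v g] by (simp add: G_adj Gg)
    then show ?thesis using Gv by (simp add: cinner_scaleC_left cinner_self g)
  qed
  then have "G = rank_one g g" by (intro blinfun_eqI) simp
  then show ?thesis using that g by (simp add: G_def)
qed

text \<open>The isometry comes from \<open>multiplicative_intertwiner\<close>. It is onto because
  each \<open>rank_one h g\<close> has a preimage \<open>X\<close> under \<open>\<Psi>\<close>, and
  then \<open>V\<close> takes \<open>X e\<close> to \<open>h\<close>.\<close>

lemma star_automorphism_spatial: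
  fixes I :: "('h::complex_hilbert_space \<Rightarrow>\<^sub>L 'h) set"
  assumes I: "operator_ideal I" and rank_one: "\<And>x y. rank_one x y \<in> I"
    and \<Psi>: "star_automorphism I \<Psi>" and e: "norm (e :: 'h) = 1"
  obtains V :: "'h \<Rightarrow>\<^sub>L 'h" where "linear_isometry V" "surj V"
    "\<And>A x. A \<in> I \<Longrightarrow> \<Psi> A (V x) = V (blinfun_apply A x)"
proof -
  note D = star_automorphismD[OF \<Psi>]
  obtain g where g: "norm g = 1" "\<Psi> (rank_one e e) = rank_one g g"
    using star_automorphism_rank_one_projection[OF I rank_one \<Psi> e] .
  have ops: "\<Psi> A \<in> bounded_ops" if "A \<in> I" for A using D(1)[OF that] operator_idealD(1)[OF I] by blast
  have scalar: "\<Psi> (rank_one (c *\<^sub>C e) e) = scale_op c (rank_one g g)" for c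
    using D(3)[OF rank_one, of c e e] by (simp add: g scale_op_rank_one)
  have bound: "norm (\<Psi> (rank_one x e) g) \<le> norm x" for x
  proof -
    let ?R = "rank_one x e"
    have "cinner (\<Psi> ?R g) (\<Psi> ?R g) = cinner ((adj (\<Psi> ?R) o\<^sub>L \<Psi> ?R) g) g"
      using cinner_adj_left[OF ops[OF rank_one], of x e] by simp
    also have "adj (\<Psi> ?R) o\<^sub>L \<Psi> ?R = \<Psi> (rank_one (cinner x x *\<^sub>C e) e)"
      using D(5)[OF rank_one, of x e] D(4)[OF rank_one rank_one, of e x x e]
      by (simp add: adj_rank_one rank_one_rank_one)
    finally have "cinner (\<Psi> ?R g) (\<Psi> ?R g) = cinner x x"
      by (simp add: scalar scale_op_apply cinner_self g cinner_scaleC_left)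
    then show ?thesis by (simp only: norm_eq_sqrt_cinner order_refl)
  qed
  obtain V where V: "linear_isometry V" "\<And>x. V x = \<Psi> (rank_one x e) g"
    "\<And>A x. A \<in> I \<Longrightarrow> \<Psi> A (V x) = V (blinfun_apply A x)"
  proof (rule multiplicative_intertwiner[OF I rank_one _ _ e g(1), of \<Psi>])
    show "\<Psi> \<in> I \<rightarrow> bounded_ops" using ops by blast
    show "multiplicative_on I \<Psi>" using D(4) by (simp add: multiplicative_on_def)
    show "\<Psi> (rank_one (c *\<^sub>C e) e) g = c *\<^sub>C g" for c
      by (simp add: scalar scale_op_apply cinner_self g)
    show "norm (adj (\<Psi> (rank_one e y)) g) \<le> norm y" for y
      using bound[of y] D(5)[OF rank_one, of e y] by (simp add: adj_rank_one)
  qed (use bound in auto)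
  have "h \<in> range V" for h
  proof -
    obtain X where X: "X \<in> I" "\<Psi> X = rank_one h g"
      using D(6) rank_one[of h g] unfolding bij_betw_def by (metis imageE)
    have "V (X e) = \<Psi> (X o\<^sub>L rank_one e e) g"
      using operator_idealD(1)[OF I X(1)] by (simp add: V(2) compose_rank_one)
    also have "\<dots> = h"
      using D(4)[OF X(1) rank_one, of e e] by (simp add: X(2) g cinner_self)
    finally show ?thesis by (metis rangeI)
  qed
  then show ?thesis using that V by blast
qed

subsection \<open>Limits of automorphisms\<close>

text \<open>Replacing \<open>C\<close> by \<open>B\<close> costs at most \<open>s - s'\<close> in
  the lower bound, and the frame is then pulled back along the unitary \<open>V\<close>. With
  \<open>V\<close> the identity and equal operators this merely lowers the constant.\<close>

lemma bounded_below_on_frame_transfer: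
  fixes A B C V :: "'h::complex_hilbert_space \<Rightarrow>\<^sub>L 'h"
  assumes V: "linear_isometry V" "surj V" "\<And>x. B (blinfun_apply V x) = V (blinfun_apply A x)"
    and close: "norm (B - C) \<le> s - s'" and C: "bounded_below_on_frame C s k"
  shows "bounded_below_on_frame A s' k"
proof -
  obtain b where b: "\<forall>i<k. \<forall>j<k. cinner (b i) (b j) = (if i = j then 1 else 0)"
      "\<And>c. s * norm (\<Sum>i<k. c i *\<^sub>C b i) \<le> norm (C (\<Sum>i<k. c i *\<^sub>C b i))"
    using C unfolding bounded_below_on_frame_def by blast
  define b' where "b' i = inv V (b i)" for i
  have b': "V (b' i) = b i" for i unfolding b'_def by (rule surj_f_inv_f[OF V(2)])
  have Vops: "V \<in> bounded_ops" using V(1) by (simp add: linear_isometry_def)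
  have "cinner (b' i) (b' j) = cinner (b i) (b j)" for i j
    using linear_isometry_cinner[OF V(1), of "b' i" "b' j"] by (simp add: b')
  moreover have "s' * norm (\<Sum>i<k. c i *\<^sub>C b' i) \<le> norm (A (\<Sum>i<k. c i *\<^sub>C b' i))" for c
  proof -
    define v where "v = (\<Sum>i<k. c i *\<^sub>C b i)"
    define v' where "v' = (\<Sum>i<k. c i *\<^sub>C b' i)"
    have v': "V v' = v"
      by (simp add: v_def v'_def blinfun.sum_right bounded_ops_scaleC[OF Vops] b')
    have norms: "norm (V x) = norm x" for x using V(1) by (simp add: linear_isometry_def)
    have "s * norm v \<le> norm (C v)" unfolding v_def by (rule b(2))
    also have "C v = B v - (B - C) v" by (simp add: blinfun.diff_left)
    also have "norm \<dots> \<le> norm (B v) + norm ((B - C) v)" by (rule norm_triangle_ineq4)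
    also have "norm ((B - C) v) \<le> (s - s') * norm v"
      by (rule order_trans[OF norm_blinfun mult_right_mono[OF close]]) simp
    finally have "s' * norm v \<le> norm (B v)" by (simp add: algebra_simps)
    also have "norm (B v) = norm (A v')" using norms[of "A v'"] V(3)[of v'] by (simp add: v')
    also have "norm v = norm v'" using norms[of v'] by (simp add: v')
    finally show ?thesis by (simp add: v'_def)
  qed
  ultimately show ?thesis unfolding bounded_below_on_frame_def using b(1) by (intro exI[of _ b']) simp
qed

lemma norm_spatial:
  assumes V: "linear_isometry V" "surj V" "\<And>x. blinfun_apply B (V x) = V (blinfun_apply A x)"
  shows "norm B = norm (A :: 'h::complex_hilbert_space \<Rightarrow>\<^sub>L 'h)"
proof (rule antisym)
  have norms: "norm (V x) = norm x" for x using V(1) by (simp add: linear_isometry_def)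
  show "norm B \<le> norm A"
  proof (rule norm_blinfun_bound)
    fix y
    obtain x where "y = V x" using V(2) by blast
    then show "norm (B y) \<le> norm A * norm y" by (simp add: V(3) norms norm_blinfun)
  qed simp
  show "norm A \<le> norm B"
  proof (rule norm_blinfun_bound)
    fix x
    show "norm (A x) \<le> norm B * norm x" using norm_blinfun[of B "V x"] by (simp add: V(3) norms)
  qed simp
qed

text \<open>\<open>nontrivial\<close> provides a unit vector and all rank one operators. The zero
  ideal is treated separately in the final proof.\<close>

locale approximate_automorphism =
  fixes I :: "('h::complex_hilbert_space \<Rightarrow>\<^sub>L 'h) set" and \<phi> :: "('h \<Rightarrow>\<^sub>L 'h) \<Rightarrow> ('h \<Rightarrow>\<^sub>L 'h)"
  assumes ideal: "operator_ideal I" and nontrivial: "\<exists>A\<in>I. A \<noteq> 0"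
    and maps: "\<phi> \<in> I \<rightarrow> I" and mult: "multiplicative_on I \<phi>"
    and approx: "\<And>A. A \<in> I \<Longrightarrow> \<exists>\<Phi> :: nat \<Rightarrow> ('h \<Rightarrow>\<^sub>L 'h) \<Rightarrow> ('h \<Rightarrow>\<^sub>L 'h).
      (\<forall>n. star_automorphism I (\<Phi> n)) \<and> (\<lambda>n. \<Phi> n A) \<longlonglongrightarrow> \<phi> A"
begin

lemmas ideal_ops = operator_idealD(1)[OF ideal]

lemma rank_one_mem: "rank_one x y \<in> I"
  using nontrivial operator_ideal_rank_one[OF ideal] by blast

lemma phi_ops: "A \<in> I \<Longrightarrow> \<phi> A \<in> bounded_ops"
  using maps ideal_ops by blast

lemma phi_mult: "A \<in> I \<Longrightarrow> B \<in> I \<Longrightarrow> \<phi> (A o\<^sub>L B) = \<phi> A o\<^sub>L \<phi> B"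
  using mult by (simp add: multiplicative_on_def)

lemma unit_vector_exists: "\<exists>e::'h. norm e = 1"
proof -
  obtain A v where "A \<in> I" "A v \<noteq> 0" using nontrivial by (metis blinfun_eqI zero_blinfun.rep_eq)
  then have "norm (sgn (A v)) = 1" by (simp add: norm_sgn)
  then show ?thesis by blast
qed

text \<open>This is the only form in which the approximating automorphisms are used from here on:
  conjugates of the one operator \<open>A\<close> by unitaries.\<close>

lemma spatial_approximation:
  assumes "A \<in> I"
  obtains B V where "B \<longlonglongrightarrow> \<phi> A" "\<And>n. linear_isometry (V n)" "\<And>n. surj (V n)"
    "\<And>n x. blinfun_apply (B n) (V n x) = V n (blinfun_apply A x)"
proof -
  obtain \<Phi> where \<Phi>: "\<And>n. star_automorphism I (\<Phi> n)" "(\<lambda>n. \<Phi> n A) \<longlonglongrightarrow> \<phi> A"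
    using approx[OF assms] by blast
  obtain e :: 'h where "norm e = 1" using unit_vector_exists by blast
  then have "\<exists>V. linear_isometry V \<and> surj V \<and> (\<forall>x. \<Phi> n A (V x) = V (blinfun_apply A x))" for n
    using star_automorphism_spatial[OF ideal rank_one_mem \<Phi>(1)[of n]] assms by metis
  then obtain V where "\<And>n. linear_isometry (V n)" "\<And>n. surj (V n)"
      "\<And>n x. \<Phi> n A (V n x) = V n (blinfun_apply A x)" by metis
  then show ?thesis using that \<Phi>(2) by blast
qed

lemma norm_phi:
  assumes "A \<in> I"
  shows "norm (\<phi> A) = norm A"
proof -
  obtain B V where B: "B \<longlonglongrightarrow> \<phi> A" "\<And>n. linear_isometry (V n)" "\<And>n. surj (V n)"
    "\<And>n x. blinfun_apply (B n) (V n x) = V n (blinfun_apply A x)"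
    using spatial_approximation[OF assms] by blast
  have "norm (B n) = norm A" for n by (rule norm_spatial[OF B(2-4)])
  then show ?thesis using tendsto_norm[OF B(1)] by (simp add: LIMSEQ_const_iff)
qed

lemma phi_id:
  assumes "id_blinfun \<in> I"
  shows "\<phi> id_blinfun = id_blinfun"
proof -
  obtain B V where B: "B \<longlonglongrightarrow> \<phi> id_blinfun" "\<And>n. linear_isometry (V n)" "\<And>n. surj (V n)"
    "\<And>n x. blinfun_apply (B n) (V n x) = V n (id_blinfun x)"
    using spatial_approximation[OF assms] by blast
  have "B n = id_blinfun" for n
  proof (rule blinfun_eqI)
    fix y
    obtain x where "y = V n x" using B(3)[of n] by blast
    then show "B n y = id_blinfun y" using B(4)[of n x] by simp
  qed
  then have "B = (\<lambda>n. id_blinfun)" by auto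
  then show ?thesis using B(1) by (simp add: LIMSEQ_const_iff)
qed

lemma rank_one_approximation:
  assumes "norm (e :: 'h) = 1"
  obtains g :: "nat \<Rightarrow> 'h" where "\<And>n. norm (g n) = 1"
    "(\<lambda>n. rank_one (c *\<^sub>C g n) (g n)) \<longlonglongrightarrow> \<phi> (rank_one (c *\<^sub>C e) e)"
proof -
  obtain B V where B: "B \<longlonglongrightarrow> \<phi> (rank_one (c *\<^sub>C e) e)" "\<And>n. linear_isometry (V n)"
      "\<And>n. surj (V n)" "\<And>n x. blinfun_apply (B n) (V n x) = V n (rank_one (c *\<^sub>C e) e x)"
    using spatial_approximation[OF rank_one_mem] by blast
  have Vops: "V n \<in> bounded_ops" for n using B(2)[of n] by (simp add: linear_isometry_def)
  have "B n = rank_one (c *\<^sub>C V n e) (V n e)" for n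
  proof (rule blinfun_eqI)
    fix v
    obtain x where "v = V n x" using B(3)[of n] by blast
    then show "B n v = rank_one (c *\<^sub>C V n e) (V n e) v"
      using B(4)[of n x] linear_isometry_cinner[OF B(2)[of n]]
      by (simp add: bounded_ops_scaleC[OF Vops])
  qed
  then have "B = (\<lambda>n. rank_one (c *\<^sub>C V n e) (V n e))" by auto
  then show ?thesis
    using that[of "\<lambda>n. V n e"] B(1,2) assms by (simp add: linear_isometry_def)
qed

text \<open>
  The identity \<open>\<langle>G z, y\<rangle> \<langle>G w, v\<rangle> = \<langle>G z, v\<rangle> \<langle>G w, y\<rangle>\<close> of rank one operators passes to limits.
\<close>

lemma phi_rank_one_projection:
  assumes e: "norm (e :: 'h) = 1"
  obtains f where "norm f = 1" "\<And>c. \<phi> (rank_one (c *\<^sub>C e) e) f = c *\<^sub>C f"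
proof -
  define P where "P c = \<phi> (rank_one (c *\<^sub>C e) e)" for c
  have P_ops: "P c \<in> bounded_ops" for c unfolding P_def by (rule phi_ops[OF rank_one_mem])
  have P_mult: "P c (P d z) = P (c * d) z" for c d z
  proof -
    have "rank_one (c *\<^sub>C e) e o\<^sub>L rank_one (d *\<^sub>C e) e = rank_one ((c * d) *\<^sub>C e) e"
      by (simp add: rank_one_rank_one cinner_scaleC_left cinner_self e mult.commute)
    then have "P (c * d) = P c o\<^sub>L P d"
      unfolding P_def using phi_mult[OF rank_one_mem rank_one_mem] by metis
    then show ?thesis by simp
  qed
  \<comment> \<open>Scalar multiples of projections satisfy this relation, and it is preserved by
    norm limits. It stands in for the unknown homogeneity of \<open>\<phi>\<close>.\<close>
  have P_square: "P c (P c z) = c *\<^sub>C P c z" for c z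
  proof -
    obtain g where g: "\<And>n. norm (g n) = (1::real)"
        "(\<lambda>n. rank_one (c *\<^sub>C g n) (g n)) \<longlonglongrightarrow> P c"
      using rank_one_approximation[OF e, of c] unfolding P_def by blast
    let ?R = "\<lambda>n. rank_one (c *\<^sub>C g n) (g n)"
    have R: "?R n (?R n z) = c *\<^sub>C ?R n z" for n
      by (simp add: cinner_scaleC_left cinner_self g mult_ac)
    show ?thesis
    proof (rule LIMSEQ_unique)
      show "(\<lambda>n. ?R n (?R n z)) \<longlonglongrightarrow> P c (P c z)"
        by (intro blinfun.tendsto g tendsto_const)
      show "(\<lambda>n. ?R n (?R n z)) \<longlonglongrightarrow> c *\<^sub>C P c z"
        unfolding R by (intro scaleC.tendsto blinfun.tendsto g tendsto_const)
    qed
  qed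
  have exchange: "cinner (P 1 z) y * cinner (P 1 w) v = cinner (P 1 z) v * cinner (P 1 w) y"
    for z w y v
  proof -
    obtain g where g: "(\<lambda>n. rank_one (1 *\<^sub>C g n) (g n)) \<longlonglongrightarrow> P 1"
      using rank_one_approximation[OF e, of 1] unfolding P_def by blast
    let ?R = "\<lambda>n. rank_one (1 *\<^sub>C g n) (g n)"
    have R: "cinner (?R n z) y * cinner (?R n w) v = cinner (?R n z) v * cinner (?R n w) y" for n
      by (simp add: cinner_scaleC_left)
    show ?thesis
    proof (rule LIMSEQ_unique)
      show "(\<lambda>n. cinner (?R n z) y * cinner (?R n w) v)
          \<longlonglongrightarrow> cinner (P 1 z) y * cinner (P 1 w) v"
        by (intro tendsto_mult cinner.tendsto blinfun.tendsto g tendsto_const)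
      show "(\<lambda>n. cinner (?R n z) y * cinner (?R n w) v)
          \<longlonglongrightarrow> cinner (P 1 z) v * cinner (P 1 w) y"
        unfolding R by (intro tendsto_mult cinner.tendsto blinfun.tendsto g tendsto_const)
    qed
  qed
  have P_zero: "c = 0" if "P c = 0" for c
  proof -
    have "rank_one (c *\<^sub>C e) e = 0"
      using norm_phi[OF rank_one_mem, of "c *\<^sub>C e" e] that by (simp add: P_def)
    then have "rank_one (c *\<^sub>C e) e e = 0" by (simp only: zero_blinfun.rep_eq)
    then have "c *\<^sub>C e = 0" by (simp add: cinner_self e)
    then have "cmod c * norm e = 0" by (simp flip: norm_scaleC)
    then show ?thesis by (simp add: e)
  qed
  have "P 1 \<noteq> 0" using P_zero[of 1] by auto
  then obtain z where z: "P 1 z \<noteq> 0" by (metis blinfun_eqI zero_blinfun.rep_eq)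
  define f where "f = sgn (P 1 z)"
  have f: "norm f = 1" using z by (simp add: f_def norm_sgn)
  have Pf: "P 1 f = f"
    using P_mult[of 1 1 z] by (simp add: f_def sgn_div_norm blinfun.scaleR_right)
  \<comment> \<open>The exchange identity with \<open>f\<close> in two places shows that the range
    of \<open>P 1\<close> is the line of \<open>f\<close>.\<close>
  have P1: "P 1 v = cinner (P 1 v) f *\<^sub>C f" for v
  proof (rule cinner_eq_left)
    show "cinner (P 1 v) y = cinner (cinner (P 1 v) f *\<^sub>C f) y" for y
      using exchange[of v y f f] by (simp add: Pf cinner_self f cinner_scaleC_left)
  qed
  \<comment> \<open>By multiplicativity \<open>P c\<close> maps \<open>f\<close> into its own line,
    and \<open>P_square\<close> leaves only the eigenvalues 0 and \<open>c\<close>. Eigenvalue 0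
    would make \<open>P c\<close> vanish, and then \<open>c = 0\<close> since \<open>\<phi>\<close>
    preserves norms.\<close>
  have "P c f = c *\<^sub>C f" for c
  proof -
    define a where "a = cinner (P 1 (P c f)) f"
    have a: "P c f = a *\<^sub>C f" using P1[of "P c f"] P_mult[of 1 c f] by (simp add: a_def)
    have "(a * a) *\<^sub>C f = (c * a) *\<^sub>C f"
      using P_square[of c f] by (simp add: a bounded_ops_scaleC[OF P_ops])
    then have "cinner ((a * a) *\<^sub>C f) f = cinner ((c * a) *\<^sub>C f) f" by simp
    then have "a * a = c * a" by (simp add: cinner_scaleC_left cinner_self f)
    moreover have "c = 0" if "a = 0"
    proof (rule P_zero, rule blinfun_eqI)
      fix v
      have "P c v = P c (P 1 v)" by (simp add: P_mult)
      also have "\<dots> = cinner (P 1 v) f *\<^sub>C P c f"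
        by (subst P1) (rule bounded_ops_scaleC[OF P_ops])
      finally show "P c v = blinfun_apply 0 v" by (simp add: a that)
    qed
    ultimately show ?thesis using a by auto
  qed
  then show ?thesis using that f by (simp add: P_def)
qed

section \<open>The isometry and the orthogonal complement of its range\<close>

text \<open>For automorphisms the two norm bounds came from compatibility with adjoints, which is
  not yet known for \<open>\<phi>\<close>; here preservation of norms replaces it.\<close>

lemma intertwining_isometry:
  obtains U where "linear_isometry U"
    "\<And>A x. A \<in> I \<Longrightarrow> \<phi> A (U x) = U (blinfun_apply A x)"
    "\<And>A x. A \<in> I \<Longrightarrow> adj (\<phi> A) (U x) = U (adj A x)"
proof -
  obtain e :: 'h where e: "norm e = 1" using unit_vector_exists by blast
  obtain f where f: "norm f = 1" "\<And>c. \<phi> (rank_one (c *\<^sub>C e) e) f = c *\<^sub>C f"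
    using phi_rank_one_projection[OF e] by blast
  have bound: "norm (T f) \<le> norm T" for T :: "'h \<Rightarrow>\<^sub>L 'h" using norm_blinfun[of T f] f by simp
  show ?thesis
  proof (rule multiplicative_intertwiner[OF ideal rank_one_mem _ mult e f])
    show "\<phi> \<in> I \<rightarrow> bounded_ops" using phi_ops by blast
    show "norm (\<phi> (rank_one x e) f) \<le> norm x" for x
      using bound[of "\<phi> (rank_one x e)"] norm_phi[OF rank_one_mem, of x e] norm_rank_one_le[of x e] e
      by simp
    show "norm (adj (\<phi> (rank_one e y)) f) \<le> norm y" for y
      using bound[of "adj (\<phi> (rank_one e y))"] norm_adj_le[OF phi_ops[OF rank_one_mem, of e y]]
        norm_phi[OF rank_one_mem, of e y] norm_rank_one_le[of e y] e
      by simp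
  qed (use that in auto)
qed

lemma phi_compact_vanishes:
  assumes U: "linear_isometry U" "\<And>A x. A \<in> I \<Longrightarrow> \<phi> A (U x) = U (blinfun_apply A x)"
      "\<And>A x. A \<in> I \<Longrightarrow> adj (\<phi> A) (U x) = U (adj A x)"
    and A: "A \<in> I" "compact_operator A" and z: "\<And>x. cinner z (U x) = 0"
  shows "\<phi> A z = 0"
proof (rule ccontr)
  assume nz: "\<phi> A z \<noteq> 0"
  then have "z \<noteq> 0" by auto
  define h where "h = (1 / norm z) *\<^sub>R z"
  have h: "norm h = 1" "\<And>x. cinner h (U x) = 0"
    using \<open>z \<noteq> 0\<close> z by (simp_all add: h_def cinner.scaleR_left)
  have hh: "cinner h h = 1" by (simp add: cinner_self h)
  have Uops: "U \<in> bounded_ops" using U(1) by (simp add: linear_isometry_def)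
  define \<sigma> where "\<sigma> = norm (\<phi> A h)"
  have \<sigma>: "\<sigma> > 0" using nz \<open>z \<noteq> 0\<close> by (simp add: \<sigma>_def h_def blinfun.scaleR_right)
  obtain N where N: "\<And>k. bounded_below_on_frame A (\<sigma> / 2) k \<Longrightarrow> k \<le> N"
    using compact_frame_bound[OF A(2), of "\<sigma> / 2"] \<sigma> by auto
  \<comment> \<open>The lower end bounds \<open>k\<close> by compactness and, being excluded, leaves
    room for \<open>s\<close> to drop when a frame is carried from \<open>\<phi> A\<close> back to
    \<open>A\<close>. The condition \<open>s < \<sigma>\<close> lets \<open>h\<close> join the
    frame.\<close>
  define K where "K = {k. \<exists>s. \<sigma> / 2 < s \<and> s < \<sigma> \<and> bounded_below_on_frame A s k}"
  have mono: "bounded_below_on_frame A s' k" if "bounded_below_on_frame A s k" "s' \<le> s" for s s' k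
    using bounded_below_on_frame_transfer[of id_blinfun A A A s s' k] that
    by (auto simp: linear_isometry_def bounded_ops_id)
  have "K \<subseteq> {..N}" unfolding K_def using N mono by fastforce
  then have finite_K: "finite K" by (rule finite_subset) simp
  have "0 \<in> K"
    \<comment> \<open>The empty frame satisfies every lower bound; \<open>3 * \<sigma> / 4\<close>
      is just a point of the interval.\<close>
    unfolding K_def bounded_below_on_frame_def using \<sigma> by (auto intro!: exI[of _ "3 * \<sigma> / 4"])
  define k where "k = Max K"
  have "k \<in> K" unfolding k_def using finite_K \<open>0 \<in> K\<close> by (intro Max_in) auto
  then obtain s where s: "\<sigma> / 2 < s" "s < \<sigma>" "bounded_below_on_frame A s k"
    unfolding K_def by blast
  obtain b where b: "\<forall>i<k. \<forall>j<k. cinner (b i) (b j) = (if i = j then 1 else 0)"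
      "\<And>c. s * norm (\<Sum>i<k. c i *\<^sub>C b i) \<le> norm (A (\<Sum>i<k. c i *\<^sub>C b i))"
    using s(3) unfolding bounded_below_on_frame_def by blast
  define b' where "b' i = (if i < k then U (b i) else h)" for i
  have orth: "cinner (U x) h = 0" for x using h(2)[of x] by (simp add: cinner_eq_0_commute)
  have "bounded_below_on_frame (\<phi> A) s (Suc k)"
    unfolding bounded_below_on_frame_def
  proof (intro exI[of _ b'] conjI allI impI)
    fix i j assume "i < Suc k" "j < Suc k"
    then show "cinner (b' i) (b' j) = (if i = j then 1 else 0)"
      using b(1) h(2) orth hh by (auto simp: b'_def linear_isometry_cinner[OF U(1)] less_Suc_eq)
  next
    fix c
    define v where "v = (\<Sum>i<k. c i *\<^sub>C b i)"
    have sum: "(\<Sum>i<Suc k. c i *\<^sub>C b' i) = U v + c k *\<^sub>C h"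
      by (simp add: b'_def v_def blinfun.sum_right bounded_ops_scaleC[OF Uops])
    have "cinner (U v) (c k *\<^sub>C h) = 0" by (simp add: cinner_scaleC_right orth)
    then have 1: "(norm (U v + c k *\<^sub>C h))\<^sup>2 = (norm v)\<^sup>2 + (cmod (c k))\<^sup>2"
      using U(1) h by (simp add: norm_add_square_orthogonal norm_scaleC linear_isometry_def)
    \<comment> \<open>The adjoint relation keeps \<open>\<phi> A h\<close> orthogonal to the range
      of \<open>U\<close>, so Pythagoras applies to the images as well as to the vectors.\<close>
    have "cinner (\<phi> A h) (U x) = 0" for x
      using U(3)[OF A(1), of x] by (simp add: cinner_adj phi_ops[OF A(1)] h)
    then have "cinner (U (A v)) (c k *\<^sub>C \<phi> A h) = 0"
      by (simp add: cinner_scaleC_right cinner_eq_0_commute)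
    then have 2: "(norm (\<phi> A (U v + c k *\<^sub>C h)))\<^sup>2 = (norm (A v))\<^sup>2 + (cmod (c k))\<^sup>2 * \<sigma>\<^sup>2"
      using U(1) by (simp add: blinfun.add_right U(2)[OF A(1)] bounded_ops_scaleC[OF phi_ops[OF A(1)]]
        norm_add_square_orthogonal norm_scaleC linear_isometry_def \<sigma>_def power_mult_distrib)
    have "(s * norm v)\<^sup>2 \<le> (norm (A v))\<^sup>2"
      using b(2)[of c] s(1) \<sigma> unfolding v_def by (intro power_mono) auto
    moreover have "s\<^sup>2 \<le> \<sigma>\<^sup>2" using s(1,2) \<sigma> by (intro power_mono) auto
    then have "(cmod (c k))\<^sup>2 * s\<^sup>2 \<le> (cmod (c k))\<^sup>2 * \<sigma>\<^sup>2" by (intro mult_left_mono) auto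
    ultimately have "(s * norm (U v + c k *\<^sub>C h))\<^sup>2 \<le> (norm (\<phi> A (U v + c k *\<^sub>C h)))\<^sup>2"
      unfolding 2 power_mult_distrib 1 by (simp add: algebra_simps)
    then show "s * norm (\<Sum>i<Suc k. c i *\<^sub>C b' i) \<le> norm (\<phi> A (\<Sum>i<Suc k. c i *\<^sub>C b' i))"
      unfolding sum by (rule power2_le_imp_le) simp
  qed
  \<comment> \<open>The midpoint of \<open>\<sigma> / 2\<close> and \<open>s\<close>: smaller than
    \<open>s\<close>, yet still admissible in \<open>K\<close>.\<close>
  moreover define s' where "s' = (s + \<sigma> / 2) / 2"
  have s': "\<sigma> / 2 < s'" "s' < s" using s(1) by (simp_all add: s'_def)
  obtain B V where B: "B \<longlonglongrightarrow> \<phi> A" "\<And>n. linear_isometry (V n)" "\<And>n. surj (V n)"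
    "\<And>n x. blinfun_apply (B n) (V n x) = V n (blinfun_apply A x)"
    using spatial_approximation[OF A(1)] by blast
  obtain n where "norm (B n - \<phi> A) < s - s'"
    using LIMSEQ_D[OF B(1), of "s - s'"] s' by auto
  ultimately have "bounded_below_on_frame A s' (Suc k)"
    using bounded_below_on_frame_transfer[OF B(2,3,4)[of n], of "\<phi> A" s s' "Suc k"] by simp
  then have "Suc k \<in> K" unfolding K_def using s' s(2) by auto
  then have "Suc k \<le> k" unfolding k_def using finite_K by (intro Max_ge)
  then show False by simp
qed

end

subsection \<open>Noncompact operators\<close>

text \<open>Orthogonally to any finite set there is a unit vector that \<open>A\<close> does not
  shrink below \<open>s\<close>. Including \<open>adj A (A x)\<close> for each earlier
  \<open>x\<close> in that set makes the images orthogonal too.\<close>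

lemma noncompact_orthonormal_sequence:
  fixes A :: "'h::complex_hilbert_space \<Rightarrow>\<^sub>L 'h"
  assumes A: "A \<in> bounded_ops" and nc: "\<not> compact_operator A"
  obtains x :: "nat \<Rightarrow> 'h" and s where "s > 0" "\<And>n. norm (x n) = 1"
    "\<And>m n. m \<noteq> n \<Longrightarrow> cinner (x m) (x n) = 0"
    "\<And>m n. m \<noteq> n \<Longrightarrow> cinner (A (x m)) (A (x n)) = 0" "\<And>n. s \<le> norm (A (x n))"
proof -
  obtain s where s: "s > 0"
      "\<And>F. finite F \<Longrightarrow> \<exists>v. (\<forall>x\<in>F. cinner v x = 0) \<and> s * norm v < norm (A v)"
    using nc unfolding compact_operator_def by (metis not_less)
  have "\<exists>v. (\<forall>x\<in>F. cinner v x = 0) \<and> norm v = 1 \<and> s \<le> norm (A v)" if F: "finite F" for F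
  proof -
    obtain v where v: "\<forall>x\<in>F. cinner v x = 0" "s * norm v < norm (A v)" using s(2)[OF F] by blast
    then have "norm v > 0" by auto
    then show ?thesis
      using v by (intro exI[of _ "(1 / norm v) *\<^sub>R v"])
        (auto simp: cinner.scaleR_left blinfun.scaleR_right pos_le_divide_eq)
  qed
  then obtain pick where pick: "\<And>F x. finite F \<Longrightarrow> x \<in> F \<Longrightarrow> cinner (pick F) x = 0"
      "\<And>F. finite F \<Longrightarrow> norm (pick F) = 1" "\<And>F. finite F \<Longrightarrow> s \<le> norm (A (pick F))"
    by metis
  define F where "F S = S \<union> (\<lambda>x. adj A (A x)) ` S" for S
  define L where "L = rec_nat {} (\<lambda>_ S. insert (pick (F S)) S)"
  have L0: "L 0 = {}" and LSuc: "L (Suc n) = insert (pick (F (L n))) (L n)" for n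
    by (simp_all add: L_def)
  define x where "x n = pick (F (L n))" for n
  have fin: "finite (F (L n))" for n by (induction n) (auto simp: L0 LSuc F_def)
  have L_mono: "x m \<in> L n" if "m < n" for m n
    using that by (induction n) (auto simp: LSuc x_def less_Suc_eq)
  have later: "cinner (x n) (x m) = 0 \<and> cinner (A (x n)) (A (x m)) = 0" if "m < n" for m n
  proof -
    have "x m \<in> F (L n)" "adj A (A (x m)) \<in> F (L n)" using L_mono[OF that] by (auto simp: F_def)
    then have "cinner (x n) (x m) = 0" "cinner (x n) (adj A (A (x m))) = 0"
      using pick(1)[OF fin] by (auto simp: x_def[of n])
    then show ?thesis by (simp add: cinner_adj[OF A])
  qed
  have "cinner (x m) (x n) = 0 \<and> cinner (A (x m)) (A (x n)) = 0" if "m \<noteq> n" for m n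
    using that later[of m n] later[of n m]
    by (cases m n rule: linorder_cases) (auto simp: cinner_eq_0_commute)
  moreover have "norm (x n) = 1" "s \<le> norm (A (x n))" for n
    using pick(2,3)[OF fin] by (auto simp: x_def)
  ultimately show ?thesis using that s(1) by blast
qed

lemma sums_cinner_blinfun:
  assumes "f sums v"
  shows "(\<lambda>n. cinner (blinfun_apply A (f n)) y) sums cinner (A v) (y :: 'h::complex_hilbert_space)"
  using bounded_linear.sums[OF bounded_linear_compose[OF cinner.bounded_linear_left
    blinfun.bounded_linear_right] assms] .

lemma sums_zero_unique: "(\<lambda>n. 0) sums a \<Longrightarrow> a = (0 :: 'a::{t2_space,comm_monoid_add})"
  by (rule sums_unique2[OF _ sums_zero])

text \<open>\<open>T\<close> carries the basis to a sequence on which \<open>A\<close> is bounded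
  below, and \<open>T'\<close> carries the orthogonal images back, so \<open>T'\<close> after
  \<open>A\<close> after \<open>T\<close> is \<open>s\<close> times the identity.\<close>

lemma operator_ideal_noncompact:
  fixes I :: "('h::complex_hilbert_space \<Rightarrow>\<^sub>L 'h) set"
  assumes separable: "separable_space (euclidean :: 'h topology)"
    and I: "operator_ideal I" and A: "A \<in> I" and nc: "\<not> compact_operator A"
  shows "id_blinfun \<in> I"
proof -
  have A_ops: "A \<in> bounded_ops" using operator_idealD(1)[OF I A] .
  obtain x :: "nat \<Rightarrow> 'h" and s where x: "s > 0" "\<And>n. norm (x n) = (1::real)"
    "\<And>m n. m \<noteq> n \<Longrightarrow> cinner (x m) (x n) = 0"
    "\<And>m n. m \<noteq> n \<Longrightarrow> cinner (A (x m)) (A (x n)) = 0" "\<And>n. s \<le> norm (A (x n))"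
    using noncompact_orthonormal_sequence[OF A_ops nc] by metis
  obtain e :: "nat \<Rightarrow> 'h" where e: "orthogonal_contractions e"
      "\<And>v. (\<lambda>k. cinner v (e k) *\<^sub>C e k) sums v"
    using separable_orthogonal_basis[OF separable] by blast
  \<comment> \<open>Scaled so that \<open>cinner (A (x n)) (y n)\<close> equals \<open>s\<close> for
    every \<open>n\<close>, while \<open>y n\<close> has norm \<open>s / norm (A (x n))\<close>,
    which is at most 1.\<close>
  define y where "y n = (s / (norm (A (x n)))\<^sup>2) *\<^sub>R A (x n)" for n
  have Ax: "norm (A (x n)) > 0" for n using x(1) x(5)[of n] by linarith
  have oc_x: "orthogonal_contractions x" using x by (simp add: orthogonal_contractions_def)
  have norm_y: "norm (y n) \<le> 1" for n
  proof -
    have "norm (y n) = s / norm (A (x n))"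
      using x(1) Ax[of n] by (simp add: y_def power2_eq_square)
    then show ?thesis using x(5)[of n] Ax[of n] by simp
  qed
  have oc_y: "orthogonal_contractions y"
    unfolding orthogonal_contractions_def
    using norm_y x(4) by (simp add: y_def cinner.scaleR_left cinner.scaleR_right)
  obtain T :: "'h \<Rightarrow>\<^sub>L 'h" where T: "T \<in> bounded_ops"
      "\<And>v. (\<lambda>n. cinner v (e n) *\<^sub>C x n) sums T v"
    using orthogonal_operator[OF e(1) oc_x] by blast
  obtain T' :: "'h \<Rightarrow>\<^sub>L 'h" where T': "T' \<in> bounded_ops"
      "\<And>v. (\<lambda>n. cinner v (y n) *\<^sub>C e n) sums T' v"
    using orthogonal_operator[OF oc_y e(1)] by blast
  have coeff: "cinner (A (T v)) (y m) = complex_of_real s * cinner v (e m)" for v m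
  proof -
    have "cinner (A (cinner v (e n) *\<^sub>C x n)) (y m)
        = (if n = m then complex_of_real s * cinner v (e m) else 0)" for n
    proof (cases "n = m")
      case True
      have "cinner (A (x m)) (y m) = s"
        using Ax[of m] by (simp add: y_def cinner.scaleR_right cinner_self scaleR_conv_of_real)
      then show ?thesis
        using True by (simp add: bounded_ops_scaleC[OF A_ops] cinner_scaleC_left mult.commute)
    qed (use x(4) in \<open>simp add: bounded_ops_scaleC[OF A_ops] cinner_scaleC_left y_def
          cinner.scaleR_right\<close>)
    then have "(\<lambda>n. if n = m then complex_of_real s * cinner v (e m) else 0) sums cinner (A (T v)) (y m)"
      using sums_cinner_blinfun[OF T(2)[of v], of A "y m"] by simp
    then show ?thesis using sums_single[of m "\<lambda>_. complex_of_real s * cinner v (e m)"] sums_unique2 by blast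
  qed
  have "T' (A (T v)) = complex_of_real s *\<^sub>C v" for v
  proof (rule sums_unique2)
    show "(\<lambda>n. cinner (A (T v)) (y n) *\<^sub>C e n) sums T' (A (T v))" by (rule T'(2))
    show "(\<lambda>n. cinner (A (T v)) (y n) *\<^sub>C e n) sums (complex_of_real s *\<^sub>C v)"
      using bounded_linear.sums[OF bounded_linear_scaleC e(2)[of v], of "complex_of_real s"]
      by (simp add: coeff)
  qed
  then have "id_blinfun = scale_op (1 / complex_of_real s) (T' o\<^sub>L (A o\<^sub>L T))"
    using x(1) by (intro blinfun_eqI) (simp add: scale_op_apply)
  moreover have "T' o\<^sub>L (A o\<^sub>L T) \<in> I" using operator_idealD(4,5)[OF I] A T(1) T'(1) by blast
  ultimately show ?thesis using operator_idealD(3)[OF I] by metis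
qed

lemma operator_ideal_id:
  assumes "operator_ideal I" "id_blinfun \<in> I"
  shows "I = bounded_ops"
proof
  show "I \<subseteq> bounded_ops" using operator_idealD(1)[OF assms(1)] by blast
  show "bounded_ops \<subseteq> I"
  proof
    fix A :: "'a \<Rightarrow>\<^sub>L 'a" assume "A \<in> bounded_ops"
    then have "id_blinfun o\<^sub>L A \<in> I" using operator_idealD(4)[OF assms] by blast
    moreover have "id_blinfun o\<^sub>L A = A" by (rule blinfun_eqI) simp
    ultimately show "A \<in> I" by simp
  qed
qed

section \<open>Uncountable families against separability\<close>

text \<open>Branches of the binary tree: \<open>k t n\<close> codes the initial segment of
  \<open>t\<close> of length \<open>n\<close>, and two different branches share only finitely many
  initial segments.\<close>

lemma almost_disjoint_sequences:
  obtains k :: "(nat \<Rightarrow> bool) \<Rightarrow> nat \<Rightarrow> nat" where "\<And>t. inj (k t)"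
    "\<And>s t. s \<noteq> t \<Longrightarrow> finite {m. \<exists>n. k s m = k t n}"
proof -
  define k where "k t n = to_nat (map t [0..<n])" for t :: "nat \<Rightarrow> bool" and n
  have k_eq: "m = n \<and> (\<forall>j<m. s j = t j)" if "k s m = k t n" for s t m n
  proof -
    have eq: "map s [0..<m] = map t [0..<n]" using that by (simp add: k_def)
    have "m = n" using arg_cong[OF eq, of length] by simp
    moreover have "s j = t j" if "j < m" for j using arg_cong[OF eq, of "\<lambda>l. l ! j"] that \<open>m = n\<close> by simp
    ultimately show ?thesis by blast
  qed
  have "finite {m. \<exists>n. k s m = k t n}" if st: "s \<noteq> t" for s t
  proof -
    obtain j where "s j \<noteq> t j" using st by blast
    then have "m \<le> j" if "k s m = k t n" for m n using k_eq[OF that] not_le by blast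
    then have "{m. \<exists>n. k s m = k t n} \<subseteq> {..j}" by blast
    then show ?thesis by (rule finite_subset) simp
  qed
  moreover have "inj (k t)" for t using k_eq by (intro injI) blast
  ultimately show ?thesis using that[of k] by blast
qed

text \<open>The balls of radius 1/2 around the \<open>g t\<close> are disjoint, so picking a point
  of a countable dense set in each would make the set of 0-1 sequences countable, against Cantor's
  diagonal argument.\<close>

lemma separable_no_uncountable_separated_family:
  fixes g :: "(nat \<Rightarrow> bool) \<Rightarrow> 'h::complex_hilbert_space"
  assumes "separable_space (euclidean :: 'h topology)"
    and sep: "\<And>s t. s \<noteq> t \<Longrightarrow> 1 \<le> norm (g s - g t)"
  shows False
proof -
  obtain C :: "'h set" where C: "countable C" "closure C = UNIV"
    using assms(1) unfolding separable_space_def by auto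
  have "\<exists>c\<in>C. dist c (g t) < 1 / 2" for t
    using C(2) closure_approachable[of "g t" C] by (metis UNIV_I half_gt_zero zero_less_one)
  then obtain c where c: "\<And>t. c t \<in> C" "\<And>t. dist (c t) (g t) < 1 / 2" by metis
  have "inj c"
  proof (rule injI, rule ccontr)
    fix s t assume "c s = c t" "s \<noteq> t"
    then have "dist (g s) (g t) < 1"
      using c(2)[of s] c(2)[of t] dist_triangle_half_r[of "c s" "g s" 1 "g t"] by simp
    then show False using sep[OF \<open>s \<noteq> t\<close>] by (simp add: dist_norm)
  qed
  then have "countable (UNIV :: (nat \<Rightarrow> bool) set)"
    using c(1) countable_subset[OF _ C(1), of "range c"] countable_image_inj_eq[of c UNIV] by auto
  then obtain f :: "nat \<Rightarrow> nat \<Rightarrow> bool" where f: "range f = UNIV"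
    using uncountable_def[of "UNIV :: (nat \<Rightarrow> bool) set"] by auto
  then obtain n where "f n = (\<lambda>i. \<not> f i i)" by (metis surjD)
  then have "f n n = (\<not> f n n)" by metis
  then show False by simp
qed

context approximate_automorphism
begin

text \<open>
  Otherwise \<open>\<phi>(W\<^sub>t) h\<close> would be an uncountable \<open>1\<close>-separated family, the \<open>W\<^sub>t\<close> being isometries into
  the closed spans of almost disjoint subsequences: \<open>W\<^sub>t' W\<^sub>t = 1\<close>, while \<open>W\<^sub>t' W\<^sub>s\<close> has finite rank for
  \<open>s \<noteq> t\<close>.
\<close>

lemma intertwining_isometry_total:
  assumes separable: "separable_space (euclidean :: 'h topology)" and id: "id_blinfun \<in> I"
    and U: "linear_isometry U" "\<And>A x. A \<in> I \<Longrightarrow> \<phi> A (U x) = U (blinfun_apply A x)"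
      "\<And>A x. A \<in> I \<Longrightarrow> adj (\<phi> A) (U x) = U (adj A x)"
    and z: "\<And>x. cinner z (U x) = 0"
  shows "z = 0"
proof (rule ccontr)
  assume "z \<noteq> 0"
  define h where "h = (1 / norm z) *\<^sub>R z"
  have h: "norm h = 1" "\<And>x. cinner h (U x) = 0"
    using \<open>z \<noteq> 0\<close> z by (simp_all add: h_def cinner.scaleR_left)
  have vanish: "\<phi> A h = 0" if "A \<in> I" "compact_operator A" for A
    by (rule phi_compact_vanishes[OF U(1) _ _ that h(2)]) (fact U(2) U(3))+
  have all: "A \<in> I" if "A \<in> bounded_ops" for A using operator_ideal_id[OF ideal id] that by simp
  \<comment> \<open>A compact identity would be mapped to an operator killing \<open>h\<close>, but
    \<open>\<phi>\<close> fixes the identity. So the space is infinite dimensional.\<close>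
  have "\<not> compact_operator (id_blinfun :: 'h \<Rightarrow>\<^sub>L 'h)"
    using vanish[OF id] phi_id[OF id] h by auto
  then obtain x :: "nat \<Rightarrow> 'h" and s :: real where x: "\<And>n. norm (x n) = (1::real)"
      "\<And>m n. m \<noteq> n \<Longrightarrow> cinner (x m) (x n :: 'h) = 0"
    using noncompact_orthonormal_sequence[OF bounded_ops_id] by metis
  have oc_x: "orthogonal_contractions x" using x by (simp add: orthogonal_contractions_def)
  obtain e :: "nat \<Rightarrow> 'h" where e: "orthogonal_contractions e"
      "\<And>v. (\<lambda>k. cinner v (e k) *\<^sub>C e k) sums v"
    using separable_orthogonal_basis[OF separable] by blast
  obtain k :: "(nat \<Rightarrow> bool) \<Rightarrow> nat \<Rightarrow> nat" where k: "\<And>t. inj (k t)"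
      "\<And>s t. s \<noteq> t \<Longrightarrow> finite {m. \<exists>n. k s m = k t n}"
    using almost_disjoint_sequences by blast
  note oc_xk = orthogonal_contractions_subseq[OF oc_x k(1)]
  have "\<exists>T. T \<in> bounded_ops \<and> (\<forall>v. (\<lambda>n. cinner v (e n) *\<^sub>C x (k t n)) sums blinfun_apply T v)" for t
    using orthogonal_operator[OF e(1) oc_xk[of t]] by metis
  then obtain W where W: "\<And>t. W t \<in> bounded_ops"
      "\<And>t v. (\<lambda>n. cinner v (e n) *\<^sub>C x (k t n)) sums blinfun_apply (W t) v" by metis
  have "\<exists>T. T \<in> bounded_ops \<and> norm T \<le> 1 \<and>
      (\<forall>v. (\<lambda>n. cinner v (x (k t n)) *\<^sub>C e n) sums blinfun_apply T v)" for t
    using orthogonal_operator[OF oc_xk[of t] e(1)] by metis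
  then obtain W' where W': "\<And>t. W' t \<in> bounded_ops" "\<And>t. norm (W' t) \<le> 1"
      "\<And>t v. (\<lambda>n. cinner v (x (k t n)) *\<^sub>C e n) sums blinfun_apply (W' t) v" by metis
  have coeff: "(\<lambda>m. cinner v (e m) * cinner (x (k s m)) (x (k t n)))
      sums cinner (W s v) (x (k t n))" for s t v n
    using bounded_linear.sums[OF cinner.bounded_linear_left W(2)[of v s], of "x (k t n)"]
    by (simp add: cinner_scaleC_left)
  have "W' t o\<^sub>L W t = id_blinfun" for t
  proof (rule blinfun_eqI)
    fix v
    have "cinner (W t v) (x (k t n)) = cinner v (e n)" for n
    proof -
      have "cinner v (e m) * cinner (x (k t m)) (x (k t n)) = (if m = n then cinner v (e n) else 0)" for m
        using x(2)[of "k t m" "k t n"] injD[OF k(1)[of t], of m n] x(1)[of "k t n"] by (auto simp: cinner_self)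
      then have "(\<lambda>m. if m = n then cinner v (e n) else 0) sums cinner (W t v) (x (k t n))"
        using coeff[of v t t n] by simp
      then show ?thesis using sums_single[of n "\<lambda>_. cinner v (e n)"] sums_unique2 by blast
    qed
    then have "(\<lambda>n. cinner v (e n) *\<^sub>C e n) sums W' t (W t v)" using W'(3)[of "W t v" t] by simp
    then show "(W' t o\<^sub>L W t) v = id_blinfun v" using e(2)[of v] sums_unique2 by fastforce
  qed
  then have same: "\<phi> (W' t) (\<phi> (W t) h) = h" for t
    using phi_mult[OF all[OF W'(1)] all[OF W(1)], of t t] phi_id[OF id]
    by (metis blinfun_apply_blinfun_compose id_blinfun.rep_eq id_apply)
  have "compact_operator (W' t o\<^sub>L W s)" if "s \<noteq> t" for s t
    unfolding compact_operator_def
  proof (intro allI impI exI conjI)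
    \<comment> \<open>The basis vectors that \<open>W s\<close> sends into the sequence belonging to
      \<open>t\<close>. Orthogonally to these finitely many vectors the product is zero.\<close>
    let ?F = "e ` {m. \<exists>n. k s m = k t n}"
    show "finite ?F" using k(2)[OF that] by simp
    fix r :: real and v assume "r > 0" "\<forall>x\<in>?F. cinner v x = 0"
    then have "cinner v (e m) * cinner (x (k s m)) (x (k t n)) = 0" for m n
      using x(2)[of "k s m" "k t n"] by auto
    then have "(\<lambda>m. 0) sums cinner (W s v) (x (k t n))" for n
      using coeff[of v s t n] by (simp only:)
    then have "cinner (W s v) (x (k t n)) = 0" for n by (rule sums_zero_unique)
    then have "(\<lambda>n. 0) sums W' t (W s v)" using W'(3)[of "W s v" t] by simp
    then have "W' t (W s v) = 0" by (rule sums_zero_unique)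
    then show "norm ((W' t o\<^sub>L W s) v) \<le> r * norm v" using \<open>r > 0\<close> by simp
  qed
  then have different: "\<phi> (W' t) (\<phi> (W s) h) = 0" if "s \<noteq> t" for s t
    using vanish[OF all[OF bounded_ops_compose[OF W'(1) W(1)]]] that
      phi_mult[OF all[OF W'(1)] all[OF W(1)], of t s] by (metis blinfun_apply_blinfun_compose)
  have "1 \<le> norm (\<phi> (W s) h - \<phi> (W t) h)" if "s \<noteq> t" for s t
  proof -
    \<comment> \<open>The operator \<open>\<phi> (W' s)\<close> is linear even though
      \<open>\<phi>\<close> is not known to be, and it is a contraction; recovering the unit vector
      \<open>h\<close> from the difference bounds the difference from below.\<close>
    have "\<phi> (W' s) (\<phi> (W s) h - \<phi> (W t) h) = h"
      using different[of t s] that by (simp add: blinfun.diff_right same)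
    then have "1 = norm (\<phi> (W' s) (\<phi> (W s) h - \<phi> (W t) h))" using h(1) by simp
    also have "\<dots> \<le> norm (\<phi> (W' s)) * norm (\<phi> (W s) h - \<phi> (W t) h)" by (rule norm_blinfun)
    also have "\<dots> \<le> 1 * norm (\<phi> (W s) h - \<phi> (W t) h)"
      using W'(2)[of s] norm_phi[OF all[OF W'(1)[of s]]] by (intro mult_right_mono) auto
    finally show ?thesis by simp
  qed
  then show False by (rule separable_no_uncountable_separated_family[OF separable])
qed

text \<open>A vector \<open>v\<close> splits into \<open>U (adj U v)\<close> and a rest orthogonal
  to the range of \<open>U\<close>; intertwining settles the first summand and \<open>zero\<close>
  the second.\<close>

lemma phi_eq_conjugation:
  assumes U: "linear_isometry U" "\<And>A x. A \<in> I \<Longrightarrow> \<phi> A (U x) = U (blinfun_apply A x)"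
    and A: "A \<in> I" and zero: "\<And>z. (\<And>x. cinner z (U x) = 0) \<Longrightarrow> \<phi> A z = 0"
  shows "\<phi> A = U o\<^sub>L A o\<^sub>L adj U"
proof (rule blinfun_eqI)
  fix v
  have Uops: "U \<in> bounded_ops" using U(1) by (simp add: linear_isometry_def)
  have "cinner (v - U (adj U v)) (U x) = 0" for x
    by (simp add: cinner.diff_left linear_isometry_cinner[OF U(1)] cinner_adj_left[OF Uops])
  then have "\<phi> A (v - U (adj U v)) = 0" by (rule zero)
  then show "\<phi> A v = (U o\<^sub>L A o\<^sub>L adj U) v"
    by (simp add: blinfun.diff_right U(2)[OF A])
qed

end

text \<open>Products are respected because \<open>adj U\<close> is a left inverse of
  \<open>U\<close>. The formula is available only on \<open>I\<close>, so the treatment of adjoints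
  relies on \<open>adj A\<close> lying in \<open>I\<close>.\<close>

lemma isometric_conjugation:
  assumes I: "operator_ideal I" and maps: "\<phi> \<in> I \<rightarrow> I" and U: "linear_isometry U"
    and \<phi>: "\<And>A. A \<in> I \<Longrightarrow> \<phi> A = U o\<^sub>L A o\<^sub>L adj (U :: 'h::complex_hilbert_space \<Rightarrow>\<^sub>L 'h)"
  shows "star_endomorphism I \<phi>"
proof -
  have Uops: "U \<in> bounded_ops" using U by (simp add: linear_isometry_def)
  have UU: "adj U (U x) = x" for x
    by (rule cinner_eq_right) (simp add: linear_isometry_cinner[OF U] flip: cinner_adj[OF Uops])
  note D = operator_idealD[OF I]
  have "\<phi> (A + B) = \<phi> A + \<phi> B" if "A \<in> I" "B \<in> I" for A B
    using that D(2) by (intro blinfun_eqI) (simp add: \<phi> blinfun.add_left blinfun.add_right)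
  moreover have "\<phi> (scale_op c A) = scale_op c (\<phi> A)" if "A \<in> I" for c A
    using that D(3) by (intro blinfun_eqI) (simp add: \<phi> scale_op_apply bounded_ops_scaleC[OF Uops])
  moreover have "\<phi> (A o\<^sub>L B) = \<phi> A o\<^sub>L \<phi> B" if "A \<in> I" "B \<in> I" for A B
    using that D(1) D(4)[of A B] by (intro blinfun_eqI) (simp add: \<phi> UU)
  moreover have "\<phi> (adj A) = adj (\<phi> A)" if "A \<in> I" for A
  proof -
    note ops = Uops bounded_ops_adj[OF Uops] D(1)[OF that] bounded_ops_adj[OF D(1)[OF that]]
    have "adj (U o\<^sub>L A o\<^sub>L adj U) = U o\<^sub>L adj A o\<^sub>L adj U"
      by (rule adj_eqI) (simp_all add: bounded_ops_compose ops cinner_adj cinner_adj_left adj_adj)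
    then show ?thesis using that operator_ideal_adj[OF I that] by (simp add: \<phi>)
  qed
  ultimately show ?thesis
    using maps by (simp add: star_endomorphism_def multiplicative_on_def)
qed

theorem mainTheorem1:
  fixes I :: "('h::complex_hilbert_space \<Rightarrow>\<^sub>L 'h) set"
    and \<phi> :: "('h \<Rightarrow>\<^sub>L 'h) \<Rightarrow> ('h \<Rightarrow>\<^sub>L 'h)"
  assumes separable: "separable_space (euclidean :: 'h topology)"
    and ideal: "operator_ideal I"
    and maps: "\<phi> \<in> I \<rightarrow> I"
    and mult: "multiplicative_on I \<phi>"
    and approx: "\<And>A. A \<in> I \<Longrightarrow> \<exists>\<Phi> :: nat \<Rightarrow> ('h \<Rightarrow>\<^sub>L 'h) \<Rightarrow> ('h \<Rightarrow>\<^sub>L 'h).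
      (\<forall>n. star_automorphism I (\<Phi> n)) \<and> (\<lambda>n. \<Phi> n A) \<longlonglongrightarrow> \<phi> A"
  shows "(I = bounded_ops \<longrightarrow> star_automorphism I \<phi>) \<and>
    (I \<subset> bounded_ops \<longrightarrow>
      (\<exists>U. linear_isometry U \<and> (\<forall>A\<in>I. \<phi> A = U o\<^sub>L A o\<^sub>L adj U)) \<and>
      star_endomorphism I \<phi>)"
proof (cases "I = {0}")
  case True
  \<comment> \<open>On the zero space \<open>{0}\<close> is all of \<open>bounded_ops\<close>, so
    both conclusions are prepared; the identity serves as \<open>U\<close>.\<close>
  have "star_endomorphism I \<phi> \<and> linear_isometry (id_blinfun :: 'h \<Rightarrow>\<^sub>L 'h) \<and>
      (\<forall>A\<in>I. \<phi> A = id_blinfun o\<^sub>L A o\<^sub>L adj id_blinfun)"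
  proof (intro conjI ballI)
    show isometry: "linear_isometry (id_blinfun :: 'h \<Rightarrow>\<^sub>L 'h)"
      by (simp add: linear_isometry_def bounded_ops_id)
    show zero: "\<phi> A = id_blinfun o\<^sub>L A o\<^sub>L adj id_blinfun" if "A \<in> I" for A
    proof -
      have "\<phi> A = 0" "A = 0" using that maps True by auto
      then show ?thesis by (intro blinfun_eqI) simp
    qed
    show "star_endomorphism I \<phi>" by (rule isometric_conjugation[OF ideal maps isometry zero])
  qed
  moreover have "bij_betw \<phi> I I" using maps True by (auto simp: bij_betw_def)
  ultimately show ?thesis unfolding star_automorphism_def by blast
next
  case False
  interpret approximate_automorphism I \<phi>
  proof
    show "\<exists>A\<in>I. A \<noteq> 0" using ideal False by (auto simp: operator_ideal_def)
  qed (use ideal maps mult approx in auto)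
  obtain U where U: "linear_isometry U"
      "\<And>A x. A \<in> I \<Longrightarrow> \<phi> A (U x) = U (blinfun_apply A x)"
      "\<And>A x. A \<in> I \<Longrightarrow> adj (\<phi> A) (U x) = U (adj A x)"
    using intertwining_isometry by blast
  have Uops: "U \<in> bounded_ops" using U(1) by (simp add: linear_isometry_def)
  have total: "z = 0" if id: "id_blinfun \<in> I" and z: "\<And>x. cinner z (U x) = 0" for z
    by (rule intertwining_isometry_total[OF separable id U(1) _ _ z]) (fact U(2) U(3))+
  have "\<phi> A z = 0" if A: "A \<in> I" and z: "\<And>x. cinner z (U x) = 0" for A z
  proof (cases "compact_operator A")
    case True
    show ?thesis by (rule phi_compact_vanishes[OF U(1) _ _ A True z]) (fact U(2) U(3))+
  next
    case False
    then have "z = 0" using total operator_ideal_noncompact[OF separable ideal A] z by blast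
    then show ?thesis by simp
  qed
  then have conj: "\<phi> A = U o\<^sub>L A o\<^sub>L adj U" if "A \<in> I" for A
    using phi_eq_conjugation[OF U(1) _ that] U(2) that by blast
  have endo: "star_endomorphism I \<phi>" by (rule isometric_conjugation[OF ideal maps U(1) conj])
  moreover have "bij_betw \<phi> I I" if full: "I = bounded_ops"
  proof (rule bij_betw_byWitness[where f' = "\<lambda>A. adj U o\<^sub>L A o\<^sub>L U"])
    have UU: "adj U (U x) = x" for x
      by (rule cinner_eq_right)
        (simp add: linear_isometry_cinner[OF U(1)] flip: cinner_adj[OF Uops])
    \<comment> \<open>When the identity lies in \<open>I\<close>, only zero is orthogonal to the
      range of \<open>U\<close>; thus \<open>U\<close> is unitary and conjugation by
      \<open>adj U\<close> inverts \<open>\<phi>\<close>.\<close>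
    have "v - U (adj U v) = 0" for v
    proof (rule total)
      show "id_blinfun \<in> I" by (simp add: full bounded_ops_id)
      show "cinner (v - U (adj U v)) (U x) = 0" for x
        by (simp add: cinner.diff_left linear_isometry_cinner[OF U(1)] cinner_adj_left[OF Uops])
    qed
    then have UU': "U (adj U v) = v" for v using eq_iff_diff_eq_0 by metis
    show mem: "(\<lambda>A. adj U o\<^sub>L A o\<^sub>L U) ` I \<subseteq> I"
      unfolding full using bounded_ops_compose bounded_ops_adj[OF Uops] Uops by blast
    show "\<forall>A\<in>I. adj U o\<^sub>L \<phi> A o\<^sub>L U = A"
      by (auto intro!: blinfun_eqI simp: conj UU)
    show "\<forall>A\<in>I. \<phi> (adj U o\<^sub>L A o\<^sub>L U) = A"
    proof
      fix A assume "A \<in> I"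
      then have "\<phi> (adj U o\<^sub>L A o\<^sub>L U) = U o\<^sub>L (adj U o\<^sub>L A o\<^sub>L U) o\<^sub>L adj U"
        using mem by (intro conj) blast
      also have "\<dots> = A" by (rule blinfun_eqI) (simp add: UU')
      finally show "\<phi> (adj U o\<^sub>L A o\<^sub>L U) = A" .
    qed
    show "\<phi> ` I \<subseteq> I" using maps by blast
  qed
  ultimately show ?thesis
    using U(1) conj unfolding star_automorphism_def by blast
qed

end
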